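(* Let $\mathcal{F}$ be a complex Hilbert space, let $Dom(H)\subset\mathcal{F}$ be a dense linear subspace, let $H\colon Dom(H)\to\mathcal{F}$ be a linear self-adjoint operator, and let $a\in\mathbb{R}$, $a\neq 0$. Let $S\colon[0,+\infty)\to\mathcal{L}(\mathcal{F})$ be a mapping that is Chernoff-tangent to $H$ and satisfies $(S(t))^*=S(t)$ for each $t\geq 0$. Then the family $\left(e^{ia(S(|t|)-I)\,\mathrm{sign}(t)}\right)_{t\in\mathbb{R}}$ is Chernoff-equivalent to the group $\left(e^{iatH}\right)_{t\in\mathbb{R}}$, and for each fixed $t\in\mathbb{R}$ and $f\in\mathcal{F}$ all of the following hold, where all the limits exist and are taken with respect to the norm in $\mathcal{F}$: (1) $$e^{iatH}f=\lim_{n\to\infty}\left(e^{ia(S(|t/n|)-I)\,\mathrm{sign}(t)}\right)^nf=\lim_{n\to\infty}e^{ian(S(|t/n|)-I)\,\mathrm{sign}(t)}f;$$ (2) $$e^{iatH}f=\lim_{n\to\infty}\lim_{k\to\infty}\sum_{m=0}^k\frac{i^ma^mn^m(\mathrm{sign}(t))^m}{m!}\big(S(|t/n|)-I\big)^mf;$$ (3) $$e^{iatH}f=\lim_{n\to\infty}\lim_{k\to\infty}\left[\left(1-\frac{ian\,\mathrm{sign}(t)}{k}\right)I+\frac{ian\,\mathrm{sign}(t)}{k}S(|t/n|)\right]^kf;$$ (4) $$e^{iatH}f=\lim_{n\to\infty}\lim_{k\to\infty}\sum_{m=0}^k\sum_{q=0}^m\frac{(-1)^{m-q}i^ma^mn^m(\mathrm{sign}(t))^m}{q!(m-q)!}\big(S(|t/n|)\big)^qf;$$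 (5) $$e^{iatH}f=\lim_{n\to\infty}\lim_{k\to\infty}\sum_{q=0}^k\frac{k!\,(k-ian\,\mathrm{sign}(t))^{k-q}(ian\,\mathrm{sign}(t))^q}{q!(k-q)!\,k^k}\big(S(|t/n|)\big)^qf;$$ (6) $$e^{iatH}f=\lim_{n\to\infty}\lim_{k\to\infty}\sum_{m=0}^k\sum_{q=0}^{k-m}\frac{(-1)^{k-m-q}k!\,(ian\,\mathrm{sign}(t))^{k-q}}{m!\,q!\,(k-m-q)!\,k^{k-q}}\big(S(|t/n|)\big)^mf.$$
   Context: Notation. $\mathcal{L}(\mathcal{F})$ is the space of all bounded linear operators on $\mathcal{F}$ (defined on all of $\mathcal{F}$), $I$ is the identity operator, and $n,k$ range over positive integers. $\mathrm{sign}(t)$ is $1$, $0$, $-1$ for $t>0$, $t=0$, $t<0$ respectively, and $0^0=1$. For a bounded operator $A$, $e^A=\sum_{k=0}^\infty A^k/k!$ (norm-convergent series). For the self-adjoint operator $H$, which may be unbounded, $\left(e^{iatH}\right)_{t\in\mathbb{R}}$ denotes the strongly continuous unitary group on $\mathcal{F}$ whose infinitesimal generator is $(iaH,Dom(H))$; it exists by Stone's theorem. Iterated limits $\lim_{n\to\infty}\lim_{k\to\infty}$ mean that for each fixed $n$ the inner limit in $k$ is taken first. Chernoff-tangency. Let $L\colon Dom(L)\to\mathcal{F}$ be a linear operator with $Dom(L)\subset\mathcal{F}$. A mapping $G$ is called Chernoff-tangent to $L$ iff: (CT1) $G$ is defined on $[0,+\infty)$, takes values in $\mathcal{L}(\mathcal{F})$,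 and $t\mapsto G(t)f$ is continuous for every $f\in\mathcal{F}$; (CT2) $G(0)=I$; (CT3) there exists a dense linear subspace $\mathcal{D}\subset\mathcal{F}$ such that for every $f\in\mathcal{D}$ the limit $G'(0)f=\lim_{t\to 0}(G(t)f-f)/t$ exists (with $t>0$); (CT4) the operator $(G'(0),\mathcal{D})$ has a closure, and this closure is $(L,Dom(L))$. Chernoff-equivalence. Two $\mathcal{L}(\mathcal{F})$-valued mappings $G_1,G_2$ both defined on $\mathbb{R}$ are called Chernoff-equivalent iff $G_1(0)=G_2(0)=I$ and for each $f\in\mathcal{F}$ and each $T>0$ $$\lim_{n\to\infty}\sup_{t\in[-T,T]}\left\|\left(G_1\left(\tfrac{t}{n}\right)\right)^nf-\left(G_2\left(\tfrac{t}{n}\right)\right)^nf\right\|=0.$$ *)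

theory Defs
  imports "HOL-Analysis.Analysis"
begin

class complex_vector = real_vector +
  fixes scaleC :: "complex \<Rightarrow> 'a \<Rightarrow> 'a"  (infixr "*\<^sub>C" 75)
  assumes scaleC_add_right: "c *\<^sub>C (x + y) = c *\<^sub>C x + c *\<^sub>C y"
    and scaleC_add_left: "(b + c) *\<^sub>C x = b *\<^sub>C x + c *\<^sub>C x"
    and scaleC_scaleC: "b *\<^sub>C c *\<^sub>C x = (b * c) *\<^sub>C x"
    and scaleC_of_real: "complex_of_real r *\<^sub>C x = r *\<^sub>R x"

text \<open>The inner product is conjugate-linear in the first argument and linear in the second.\<close>

class complex_inner = complex_vector + real_normed_vector +
  fixes cinner :: "'a \<Rightarrow> 'a \<Rightarrow> complex"
  assumes cinner_commute: "cinner x y = cnj (cinner y x)"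
    and cinner_add_right: "cinner x (y + z) = cinner x y + cinner x z"
    and cinner_scaleC_right: "cinner x (c *\<^sub>C y) = c * cinner x y"
    and norm_eq_sqrt_cinner: "norm x = sqrt (Re (cinner x x))"

class complex_hilbert = complex_inner + complete_space
begin

subclass banach ..

end

definition bounded_clinear :: "('a::complex_inner \<Rightarrow> 'a) \<Rightarrow> bool" where
  "bounded_clinear A \<longleftrightarrow> bounded_linear A \<and> (\<forall>c x. A (c *\<^sub>C x) = c *\<^sub>C A x)"

definition csubspace :: "'a::complex_vector set \<Rightarrow> bool" where
  "csubspace D \<longleftrightarrow> subspace D \<and> (\<forall>c. \<forall>x\<in>D. c *\<^sub>C x \<in> D)"

text \<open>An unbounded operator is a pair of a domain \<open>D\<close> and a total function \<open>A\<close>; the values of \<open>A\<close>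
  outside \<open>D\<close> are irrelevant.\<close>

definition clinear_on :: "'a::complex_vector set \<Rightarrow> ('a \<Rightarrow> 'a) \<Rightarrow> bool" where
  "clinear_on D A \<longleftrightarrow> (\<forall>x\<in>D. \<forall>y\<in>D. A (x + y) = A x + A y) \<and> (\<forall>c. \<forall>x\<in>D. A (c *\<^sub>C x) = c *\<^sub>C A x)"

definition op_graph :: "'a set \<Rightarrow> ('a \<Rightarrow> 'a) \<Rightarrow> ('a \<times> 'a) set" where
  "op_graph D A = {(x, A x) |x. x \<in> D}"

text \<open>The operator \<open>(A, D)\<close> has a closure, namely \<open>(B, E)\<close>.\<close>

definition is_op_closure ::
    "'a::topological_space set \<Rightarrow> ('a \<Rightarrow> 'a) \<Rightarrow> 'a set \<Rightarrow> ('a \<Rightarrow> 'a) \<Rightarrow> bool" where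
  "is_op_closure D A E B \<longleftrightarrow> closure (op_graph D A) = op_graph E B"

definition cadjoint_dom :: "'a::complex_inner set \<Rightarrow> ('a \<Rightarrow> 'a) \<Rightarrow> 'a set" where
  "cadjoint_dom D A = {y. \<exists>z. \<forall>x\<in>D. cinner y (A x) = cinner z x}"

text \<open>The vector \<open>z\<close> is unique because this is only used for dense \<open>D\<close>.\<close>

definition cadjoint :: "'a::complex_inner set \<Rightarrow> ('a \<Rightarrow> 'a) \<Rightarrow> 'a \<Rightarrow> 'a" where
  "cadjoint D A y = (THE z. \<forall>x\<in>D. cinner y (A x) = cinner z x)"

definition self_adjoint :: "'a::complex_inner set \<Rightarrow> ('a \<Rightarrow> 'a) \<Rightarrow> bool" where
  "self_adjoint D A \<longleftrightarrow> cadjoint_dom D A = D \<and> (\<forall>y\<in>D. cadjoint D A y = A y)"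

text \<open>The exponential series of a bounded operator, summed in the operator norm.\<close>

definition op_exp :: "('a::real_normed_vector \<Rightarrow> 'a) \<Rightarrow> 'a \<Rightarrow> 'a" where
  "op_exp A = blinfun_apply (\<Sum>k. Blinfun (A ^^ k) /\<^sub>R fact k)"

text \<open>Derivative at zero of an operator family; the filter is \<open>at 0\<close> for groups and
  \<open>at_right 0\<close> for families defined on the nonnegative half-line.\<close>

definition deriv0_dom :: "real filter \<Rightarrow> (real \<Rightarrow> 'a::real_normed_vector \<Rightarrow> 'a) \<Rightarrow> 'a set" where
  "deriv0_dom F G = {f. \<exists>l. ((\<lambda>t. (G t f - f) /\<^sub>R t) \<longlongrightarrow> l) F}"

definition deriv0 :: "real filter \<Rightarrow> (real \<Rightarrow> 'a::real_normed_vector \<Rightarrow> 'a) \<Rightarrow> 'a \<Rightarrow> 'a" where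
  "deriv0 F G f = Lim F (\<lambda>t. (G t f - f) /\<^sub>R t)"

definition unitary :: "('a::complex_inner \<Rightarrow> 'a) \<Rightarrow> bool" where
  "unitary V \<longleftrightarrow> bounded_clinear V \<and> surj V \<and> (\<forall>x y. cinner (V x) (V y) = cinner x y)"

definition sc_unitary_group :: "(real \<Rightarrow> 'a::complex_inner \<Rightarrow> 'a) \<Rightarrow> bool" where
  "sc_unitary_group U \<longleftrightarrow>
     (\<forall>t. unitary (U t)) \<and> U 0 = id \<and> (\<forall>s t. U (s + t) = U s \<circ> U t) \<and>
     (\<forall>f. continuous_on UNIV (\<lambda>t. U t f))"

definition is_generator ::
    "(real \<Rightarrow> 'a::real_normed_vector \<Rightarrow> 'a) \<Rightarrow> 'a set \<Rightarrow> ('a \<Rightarrow> 'a) \<Rightarrow> bool" where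
  "is_generator U D A \<longleftrightarrow> deriv0_dom (at 0) U = D \<and> (\<forall>f\<in>D. deriv0 (at 0) U f = A f)"

text \<open>\<open>unitary_group_gen D A\<close> is the group generated by \<open>(A, D)\<close>. For \<open>A = \<i>aH\<close> with \<open>(H, D)\<close>
  self-adjoint and \<open>a\<close> real and nonzero, it exists by Stone's theorem; a group is determined by
  its generator.\<close>

definition unitary_group_gen :: "'a::complex_inner set \<Rightarrow> ('a \<Rightarrow> 'a) \<Rightarrow> real \<Rightarrow> 'a \<Rightarrow> 'a" where
  "unitary_group_gen D A = (THE U. sc_unitary_group U \<and> is_generator U D A)"

text \<open>The values of \<open>G\<close> at negative arguments are irrelevant here.\<close>

definition chernoff_tangent ::
    "(real \<Rightarrow> 'a::complex_inner \<Rightarrow> 'a) \<Rightarrow> 'a set \<Rightarrow> ('a \<Rightarrow> 'a) \<Rightarrow> bool" where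
  "chernoff_tangent G DomL L \<longleftrightarrow>
     (\<forall>t\<ge>0. bounded_clinear (G t)) \<and> (\<forall>f. continuous_on {0..} (\<lambda>t. G t f)) \<and>
     G 0 = id \<and>
     (\<exists>D. csubspace D \<and> closure D = UNIV \<and> D \<subseteq> deriv0_dom (at_right 0) G \<and>
          is_op_closure D (deriv0 (at_right 0) G) DomL L)"

text \<open>The supremum is taken in the extended reals, so that an unbounded set has supremum \<open>\<infinity>\<close>.\<close>

definition chernoff_equivalent ::
    "(real \<Rightarrow> 'a::complex_inner \<Rightarrow> 'a) \<Rightarrow> (real \<Rightarrow> 'a \<Rightarrow> 'a) \<Rightarrow> bool" where
  "chernoff_equivalent G1 G2 \<longleftrightarrow>
     (\<forall>t. bounded_clinear (G1 t)) \<and> (\<forall>t. bounded_clinear (G2 t)) \<and>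
     G1 0 = id \<and> G2 0 = id \<and>
     (\<forall>f. \<forall>T>0. (\<lambda>n. SUP t\<in>{-T..T}.
         ereal (norm ((G1 (t / real n) ^^ n) f - (G2 (t / real n) ^^ n) f))) \<longlonglongrightarrow> 0)"

text \<open>\<open>lim\<^bsub>n\<rightarrow>\<infinity>\<^esub> lim\<^bsub>k\<rightarrow>\<infinity>\<^esub> X n k = l\<close>, where the inner limit has to exist for every positive \<open>n\<close>.\<close>

definition iterated_limit :: "(nat \<Rightarrow> nat \<Rightarrow> 'a::t2_space) \<Rightarrow> 'a \<Rightarrow> bool" where
  "iterated_limit X l \<longleftrightarrow> (\<forall>n>0. convergent (X n)) \<and> (\<lambda>n. lim (X n)) \<longlonglongrightarrow> l"

end

theory Submission
  imports Defs
begin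

text \<open>
  Write \<open>K = aH\<close> and \<open>B s = a (S \<bar>s\<bar> - I) / \<bar>s\<bar>\<close>. The operators \<open>B s\<close> are bounded and self-adjoint,
  they converge to \<open>K\<close> on a core of \<open>K\<close> as \<open>s \<rightarrow> 0\<close>, and since \<open>a n sgn t = t a / \<bar>t / n\<bar>\<close> the operators in
  the theorem are \<open>e\<^sup>i\<^sup>t\<^sup>B\<close> with \<open>B = B (t / n)\<close>. So everything reduces to a Trotter--Kato theorem:
  \<open>e\<^sup>i\<^sup>t\<^sup>B \<rightarrow> e\<^sup>i\<^sup>t\<^sup>K\<close> strongly, uniformly for \<open>t\<close> in bounded intervals, as \<open>B = B s\<close> with \<open>s \<rightarrow> 0\<close>. The group \<open>e\<^sup>i\<^sup>t\<^sup>K\<close>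
  itself is obtained as the limit of the groups generated by the (commuting) symmetrized yosidaida
  approximations of \<open>K\<close>. Both limits rest on a Duhamel estimate that needs no integration, because
  unitarity lets one pair a perturbed orbit with an exact one. The inner limits in (2)--(6) are the
  exponential series and Euler's formula \<open>(I + Y / k)\<^sup>k \<rightarrow> e\<^sup>Y\<close> for bounded \<open>Y\<close>, rewritten by the binomial
  theorem.
\<close>

section \<open>Complex Hilbert spaces\<close>

text \<open>Tangency gives convergence of \<open>B s\<close> only on a subspace that the group of
  \<open>K\<close> may fail to preserve, so \<open>B s\<close> cannot be followed along an orbit
  \<open>U t x\<close>. Resolvents at \<i> remove this obstacle: they are contractions for all
  operators involved, and \<open>K - \<i>\<close> carries a core of \<open>K\<close> onto a dense
  set, so convergence on the core becomes strong convergence of the resolvents everywhere.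
  Uniformity in \<open>t\<close> matters even for a single evaluation at \<open>s = t / n\<close>,
  because the approximating operator then changes with \<open>t\<close>; a bound for each small
  \<open>s\<close> that holds for all \<open>t\<close> in an interval at once can be specialized to
  this diagonal. The group is given by a definite description, so existence and uniqueness both have
  to be proved. One Duhamel estimate serves for the Cauchy property of the approximating groups, for
  uniqueness and for the comparison through resolvents.\<close>

lemma scaleC_one [simp]: "1 *\<^sub>C x = (x::'a::complex_vector)"
  using scaleC_of_real[of 1 x] by simp

lemma scaleC_zero_left [simp]: "0 *\<^sub>C x = (0::'a::complex_vector)"
  using scaleC_of_real[of 0 x] by simp

lemma scaleC_zero_right [simp]: "c *\<^sub>C 0 = (0::'a::complex_vector)"
  using scaleC_add_right[of c 0 0] by simp

lemma scaleC_minus_left: "(- c) *\<^sub>C x = - (c *\<^sub>C (x::'a::complex_vector))"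
  using scaleC_add_left[of "-c" c x] by (simp add: eq_neg_iff_add_eq_0)

lemma scaleC_minus_right: "c *\<^sub>C (- x) = - (c *\<^sub>C (x::'a::complex_vector))"
  using scaleC_add_right[of c "-x" x] by (simp add: eq_neg_iff_add_eq_0)

lemma scaleC_diff_left: "(b - c) *\<^sub>C x = b *\<^sub>C x - c *\<^sub>C (x::'a::complex_vector)"
  using scaleC_add_left[of b "-c" x] by (simp add: scaleC_minus_left)

lemma scaleC_diff_right: "c *\<^sub>C (x - y) = c *\<^sub>C x - c *\<^sub>C (y::'a::complex_vector)"
  using scaleC_add_right[of c x "-y"] by (simp add: scaleC_minus_right)

lemma scaleC_sum_right: "c *\<^sub>C (\<Sum>i\<in>A. g i) = (\<Sum>i\<in>A. c *\<^sub>C (g i::'a::complex_vector))"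
  by (induction A rule: infinite_finite_induct) (auto simp: scaleC_add_right)

lemma scaleC_sum_left: "(\<Sum>i\<in>A. g i) *\<^sub>C x = (\<Sum>i\<in>A. g i *\<^sub>C (x::'a::complex_vector))"
  by (induction A rule: infinite_finite_induct) (auto simp: scaleC_add_left)

lemma scaleC_scaleR: "c *\<^sub>C r *\<^sub>R x = r *\<^sub>R c *\<^sub>C (x::'a::complex_vector)"
  unfolding scaleC_of_real[symmetric] by (simp add: scaleC_scaleC mult.commute)

lemma scaleC_eq_0_iff [simp]: "c *\<^sub>C x = 0 \<longleftrightarrow> c = 0 \<or> x = (0::'a::complex_vector)"
proof -
  have "x = 0" if "c *\<^sub>C x = 0" "c \<noteq> 0"
  proof -
    have "x = inverse c *\<^sub>C c *\<^sub>C x" using that(2) by (simp add: scaleC_scaleC)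
    thus ?thesis using that(1) by simp
  qed
  thus ?thesis by auto
qed

lemmas scaleC_simps = scaleC_add_right scaleC_add_left scaleC_diff_right scaleC_diff_left
  scaleC_minus_left scaleC_minus_right scaleC_scaleC

section \<open>Inner products and the Cauchy-Schwarz inequality\<close>

lemma cinner_zero_right [simp]: "cinner x 0 = 0"
  using cinner_scaleC_right[of x 0 0] by simp

lemma cinner_minus_right: "cinner x (- y) = - cinner x y"
  using cinner_scaleC_right[of x "-1" y] by (simp add: scaleC_minus_left)

lemma cinner_diff_right: "cinner x (y - z) = cinner x y - cinner x z"
  using cinner_add_right[of x y "-z"] by (simp add: cinner_minus_right)

lemma cinner_scaleR_right: "cinner x (r *\<^sub>R y) = r *\<^sub>R cinner x y"
  by (simp add: scaleC_of_real[symmetric] cinner_scaleC_right scaleR_conv_of_real)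

lemma cinner_zero_left [simp]: "cinner 0 x = 0"
  by (subst cinner_commute) simp

lemma cinner_add_left: "cinner (x + y) z = cinner x z + cinner y z"
  by (subst (1 2 3) cinner_commute) (simp add: cinner_add_right)

lemma cinner_diff_left: "cinner (x - y) z = cinner x z - cinner y z"
  by (subst (1 2 3) cinner_commute) (simp add: cinner_diff_right)

lemma cinner_minus_left: "cinner (- x) z = - cinner x z"
  by (subst (1 2) cinner_commute) (simp add: cinner_minus_right)

lemma cinner_scaleC_left: "cinner (c *\<^sub>C x) y = cnj c * cinner x y"
  by (subst (1 2) cinner_commute) (simp add: cinner_scaleC_right)

lemma cinner_scaleR_left: "cinner (r *\<^sub>R x) y = r *\<^sub>R cinner x y"
  by (simp add: scaleC_of_real[symmetric] cinner_scaleC_left scaleR_conv_of_real)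

lemmas cinner_simps = cinner_add_right cinner_add_left cinner_diff_right cinner_diff_left
  cinner_scaleC_right cinner_scaleC_left cinner_minus_right cinner_minus_left

lemma cinner_self: "cinner x x = of_real ((norm x)\<^sup>2)"
proof -
  have im: "Im (cinner x x) = 0"
    using arg_cong[OF cinner_commute[of x x], of Im] by simp
  have "Re (cinner x x) \<ge> 0"
    using norm_ge_zero[of x] unfolding norm_eq_sqrt_cinner by simp
  hence "(norm x)\<^sup>2 = Re (cinner x x)" by (simp add: norm_eq_sqrt_cinner)
  with im show ?thesis by (simp add: complex_eq_iff)
qed

lemma norm_power2_cinner: "(norm x)\<^sup>2 = Re (cinner x x)"
  by (simp add: cinner_self)

lemma norm_scaleC: "norm (c *\<^sub>C x) = cmod c * norm (x::'a::complex_inner)"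
proof -
  have "(norm (c *\<^sub>C x))\<^sup>2 = (cmod c * norm x)\<^sup>2"
  proof -
    have "cinner (c *\<^sub>C x) (c *\<^sub>C x) = (c * cnj c) * cinner x x"
      by (simp add: cinner_simps)
    also have "\<dots> = of_real ((cmod c)\<^sup>2 * (norm x)\<^sup>2)"
      by (simp only: complex_norm_square[symmetric] cinner_self of_real_mult)
    finally show ?thesis
      by (simp only: norm_power2_cinner[of "c *\<^sub>C x"] Re_complex_of_real power_mult_distrib)
  qed
  thus ?thesis by simp
qed

lemma norm_power2_add:
  "(norm (x + y))\<^sup>2 = (norm x)\<^sup>2 + 2 * Re (cinner x y) + (norm (y::'a::complex_inner))\<^sup>2"
proof -
  have "Re (cinner y x) = Re (cinner x y)"
    by (subst cinner_commute) simp
  thus ?thesis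
    by (simp add: norm_power2_cinner cinner_simps)
qed

lemma norm_power2_diff:
  "(norm (x - y))\<^sup>2 = (norm x)\<^sup>2 - 2 * Re (cinner x y) + (norm (y::'a::complex_inner))\<^sup>2"
  using norm_power2_add[of x "-y"] by (simp add: cinner_minus_right)

lemma Re_cnj_mult_divide: "Re (cnj z / of_real r * z) = (cmod z)\<^sup>2 / r"
proof -
  have "cnj z / of_real r * z = of_real ((cmod z)\<^sup>2 / r)"
    by (simp only: of_real_divide complex_norm_square) (simp add: mult.commute)
  thus ?thesis by (simp only: Re_complex_of_real)
qed

text \<open>The squared norm of \<open>c *\<^sub>C x - y\<close> is nonnegative for every
  \<open>c\<close>; the coefficient chosen projects \<open>y\<close> onto the line of
  \<open>x\<close>.\<close>

lemma cmod_cinner_le: "cmod (cinner x y) \<le> norm x * norm (y::'a::complex_inner)"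
proof (cases "x = 0")
  case False
  define c where "c = cinner x y / of_real ((norm x)\<^sup>2)"
  have n0: "norm x \<noteq> 0" using False by simp
  have "Re (cinner (c *\<^sub>C x) y) = (cmod (cinner x y))\<^sup>2 / (norm x)\<^sup>2"
    unfolding c_def cinner_scaleC_left complex_cnj_divide complex_cnj_complex_of_real
    by (rule Re_cnj_mult_divide)
  moreover have "(norm (c *\<^sub>C x))\<^sup>2 = (cmod (cinner x y))\<^sup>2 / (norm x)\<^sup>2"
    using n0 by (simp add: norm_scaleC c_def norm_divide power_mult_distrib power_divide
        flip: of_real_power) (simp add: power2_eq_square power4_eq_xxxx)
  ultimately have "0 \<le> (norm y)\<^sup>2 - (cmod (cinner x y))\<^sup>2 / (norm x)\<^sup>2"
    using norm_power2_diff[of "c *\<^sub>C x" y] zero_le_power2[of "norm (c *\<^sub>C x - y)"] by linarith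
  hence "(cmod (cinner x y))\<^sup>2 \<le> (norm x * norm y)\<^sup>2"
    using n0 by (simp add: field_simps power_mult_distrib)
  thus ?thesis by (rule power2_le_imp_le) simp
qed simp

lemma bounded_bilinear_cinner: "bounded_bilinear (cinner :: 'a::complex_inner \<Rightarrow> 'a \<Rightarrow> complex)"
  by standard
    (auto simp: cinner_simps cinner_scaleR_left cinner_scaleR_right intro!: exI[of _ 1] cmod_cinner_le)

lemma bounded_bilinear_scaleC:
  "bounded_bilinear (scaleC :: complex \<Rightarrow> 'a::complex_inner \<Rightarrow> 'a)"
proof
  show "\<exists>K. \<forall>a b. norm (a *\<^sub>C (b::'a)) \<le> norm a * norm b * K"
    by (rule exI[of _ 1]) (simp add: norm_scaleC)
  show "(r *\<^sub>R a) *\<^sub>C b = r *\<^sub>R a *\<^sub>C b" for r a and b :: 'a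
    by (simp add: scaleR_conv_of_real scaleC_scaleC[symmetric] scaleC_of_real)
qed (auto simp: scaleC_simps scaleC_scaleR)

lemmas tendsto_cinner [tendsto_intros] = bounded_bilinear.tendsto[OF bounded_bilinear_cinner]
lemmas tendsto_scaleC [tendsto_intros] = bounded_bilinear.tendsto[OF bounded_bilinear_scaleC]
lemmas bounded_linear_scaleC_right = bounded_bilinear.bounded_linear_right[OF bounded_bilinear_scaleC]

lemma bounded_clinear_bounded_linear: "bounded_clinear A \<Longrightarrow> bounded_linear A"
  by (simp add: bounded_clinear_def)

lemma bounded_clinear_scaleC: "bounded_clinear A \<Longrightarrow> A (c *\<^sub>C x) = c *\<^sub>C A x"
  by (simp add: bounded_clinear_def)

lemma bounded_clinearI:
  assumes "\<And>x y. A (x + y) = A x + A y" "\<And>c x. A (c *\<^sub>C x) = c *\<^sub>C A x"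
    "\<And>x. norm (A x) \<le> norm x * K"
  shows "bounded_clinear A"
  unfolding bounded_clinear_def
  using assms by (auto intro!: bounded_linear_intro simp flip: scaleC_of_real)

lemma csubspaceD:
  assumes "csubspace D"
  shows "0 \<in> D" "x \<in> D \<Longrightarrow> y \<in> D \<Longrightarrow> x + y \<in> D" "x \<in> D \<Longrightarrow> y \<in> D \<Longrightarrow> x - y \<in> D"
    "x \<in> D \<Longrightarrow> c *\<^sub>C x \<in> D"
  using assms unfolding csubspace_def by (auto simp: subspace_0 subspace_add subspace_diff)

text \<open>The difference \<open>y - z\<close> is a limit of vectors orthogonal to it, hence
  orthogonal to itself. This gives the uniqueness behind the definite description in
  \<open>cadjoint\<close>.\<close>

lemma eq_if_cinner_eq_on_dense:
  fixes y z :: "'a::complex_inner"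
  assumes "closure D = UNIV" "\<And>x. x \<in> D \<Longrightarrow> cinner y x = cinner z x"
  shows "y = z"
proof -
  obtain x where x: "\<And>n. x n \<in> D" "x \<longlonglongrightarrow> y - z"
    using assms(1) closure_sequential[of "y - z" D] by auto
  have "(\<lambda>n. cinner (y - z) (x n)) \<longlonglongrightarrow> cinner (y - z) (y - z)"
    by (intro tendsto_intros x)
  moreover have "(\<lambda>n. cinner (y - z) (x n)) = (\<lambda>_. 0)"
    using assms(2) x(1) by (simp add: cinner_diff_left)
  ultimately have "cinner (y - z) (y - z) = 0"
    by (metis LIMSEQ_unique tendsto_const)
  thus ?thesis by (simp add: cinner_self)
qed

section \<open>Orthogonal vectors and the Riesz representation\<close>

text \<open>A minimizing sequence for the distance to \<open>M\<close> is Cauchy by the parallelogram law.\<close>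

lemma exists_closest_point:
  fixes M :: "'a::complex_hilbert set"
  assumes "subspace M" "closed M"
  shows "\<exists>m\<in>M. \<forall>v\<in>M. norm (x - m) \<le> norm (x - v)"
proof -
  define d where "d = Inf ((\<lambda>v. (norm (x - v))\<^sup>2) ` M)"
  have ne: "M \<noteq> {}" using subspace_0[OF assms(1)] by auto
  have bdd: "bdd_below ((\<lambda>v. (norm (x - v))\<^sup>2) ` M)"
    by (rule bdd_belowI2[of _ 0]) simp
  have dle: "d \<le> (norm (x - v))\<^sup>2" if "v \<in> M" for v
    unfolding d_def using that bdd by (rule cINF_lower[rotated])
  have "\<exists>v\<in>M. (norm (x - v))\<^sup>2 < d + 1 / real (Suc n)" for n
    using cInf_lessD[of "(\<lambda>v. (norm (x - v))\<^sup>2) ` M" "d + 1 / real (Suc n)"] ne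
    by (auto simp: d_def)
  then obtain v where v: "\<And>n. v n \<in> M" "\<And>n. (norm (x - v n))\<^sup>2 < d + 1 / real (Suc n)"
    by metis
  have par: "(norm (v m - v n))\<^sup>2 \<le> 2 / real (Suc m) + 2 / real (Suc n)" for m n
  proof -
    define p q where "p = x - v m" and "q = x - v n"
    \<comment> \<open>The midpoint is again a competitor, so \<open>p + q\<close> has squared norm
      at least \<open>4 * d\<close>; the parallelogram law then leaves for \<open>p - q\<close> only
      the two excesses over \<open>d\<close>.\<close>
    have mid: "(1/2) *\<^sub>R (v m + v n) \<in> M"
      using v(1) assms(1) by (simp add: subspace_add subspace_scale)
    have "p + q = 2 *\<^sub>R (x - (1/2) *\<^sub>R (v m + v n))"
      by (simp add: p_def q_def algebra_simps scaleR_2)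
    hence "(norm (p + q))\<^sup>2 = 4 * (norm (x - (1/2) *\<^sub>R (v m + v n)))\<^sup>2"
      by (simp add: power_mult_distrib)
    with dle[OF mid] have "4 * d \<le> (norm (p + q))\<^sup>2" by simp
    moreover have "(norm (p - q))\<^sup>2 = (norm (v m - v n))\<^sup>2"
      by (simp add: p_def q_def norm_minus_commute)
    ultimately show ?thesis
      using norm_power2_add[of p q] norm_power2_diff[of p q] v(2)[of m] v(2)[of n]
      unfolding p_def q_def by linarith
  qed
  have "Cauchy v"
  proof (rule metric_CauchyI)
    fix e :: real assume e: "e > 0"
    obtain N where N: "4 / real (Suc N) < e\<^sup>2"
      using e reals_Archimedean[of "e\<^sup>2 / 4"] by (auto simp: field_simps)
    show "\<exists>N. \<forall>m\<ge>N. \<forall>n\<ge>N. dist (v m) (v n) < e"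
    proof (intro exI allI impI)
      fix m n assume mn: "m \<ge> N" "n \<ge> N"
      have "2 / real (Suc m) \<le> 2 / real (Suc N)" "2 / real (Suc n) \<le> 2 / real (Suc N)"
        using mn by (auto simp: frac_le)
      with par[of m n] N have "(norm (v m - v n))\<^sup>2 < e\<^sup>2" by linarith
      thus "dist (v m) (v n) < e"
        using e by (simp add: dist_norm power2_less_imp_less)
    qed
  qed
  then obtain m where m: "v \<longlonglongrightarrow> m" by (auto simp: Cauchy_convergent_iff convergent_def)
  have mM: "m \<in> M" using closed_sequentially[OF assms(2) _ m] v(1) by auto
  have l1: "(\<lambda>n. (norm (x - v n))\<^sup>2) \<longlonglongrightarrow> (norm (x - m))\<^sup>2" by (intro tendsto_intros m)
  have l2: "(\<lambda>n. d + 1 / real (Suc n)) \<longlonglongrightarrow> d + 0"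
    by (intro tendsto_intros) (use LIMSEQ_inverse_real_of_nat in \<open>simp add: field_simps\<close>)
  have "(norm (x - m))\<^sup>2 \<le> d"
    using LIMSEQ_le[OF l1 l2] v(2) by (auto intro: less_imp_le)
  hence "\<forall>u\<in>M. (norm (x - m))\<^sup>2 \<le> (norm (x - u))\<^sup>2" using dle order_trans by blast
  with mM show ?thesis by (metis norm_ge_zero power2_le_imp_le)
qed

text \<open>For \<open>x\<close> outside \<open>M\<close> with closest point \<open>m\<close>, the
  residue \<open>y = x - m\<close> works: if \<open>cinner y v\<close> were nonzero, moving
  \<open>m\<close> by the projection of \<open>y\<close> on \<open>v\<close> would lower the squared
  distance by \<open>(cmod (cinner y v))\<^sup>2 / (norm v)\<^sup>2\<close>.\<close>

lemma exists_orthogonal: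
  fixes M :: "'a::complex_hilbert set"
  assumes M: "csubspace M" and "closed M" and "M \<noteq> UNIV"
  shows "\<exists>y. y \<noteq> 0 \<and> (\<forall>v\<in>M. cinner y v = 0)"
proof -
  have sub: "subspace M" using M by (simp add: csubspace_def)
  obtain x where x: "x \<notin> M" using assms(3) by auto
  obtain m where m: "m \<in> M" "\<forall>v\<in>M. norm (x - m) \<le> norm (x - v)"
    using exists_closest_point[OF sub assms(2)] by blast
  define y where "y = x - m"
  have "cinner y v = 0" if v: "v \<in> M" for v
  proof (rule ccontr)
    assume nz: "cinner y v \<noteq> 0"
    hence v0: "norm v \<noteq> 0" by auto
    define c where "c = cnj (cinner y v) / of_real ((norm v)\<^sup>2)"
    have "m + c *\<^sub>C v \<in> M" using m v M by (auto intro!: csubspaceD)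
    hence "norm y \<le> norm (y - c *\<^sub>C v)"
      using m(2) by (auto simp: y_def diff_diff_eq)
    hence "(norm y)\<^sup>2 \<le> (norm (y - c *\<^sub>C v))\<^sup>2" by simp
    moreover have "Re (cinner y (c *\<^sub>C v)) = (cmod (cinner y v))\<^sup>2 / (norm v)\<^sup>2"
      unfolding c_def cinner_scaleC_right by (rule Re_cnj_mult_divide)
    moreover have "(norm (c *\<^sub>C v))\<^sup>2 = (cmod (cinner y v))\<^sup>2 / (norm v)\<^sup>2"
      using v0 by (simp add: norm_scaleC c_def norm_divide power_mult_distrib power_divide
        flip: of_real_power) (simp add: power2_eq_square power4_eq_xxxx)
    ultimately have "(cmod (cinner y v))\<^sup>2 / (norm v)\<^sup>2 \<le> 0"
      using norm_power2_diff[of y "c *\<^sub>C v"] by linarith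
    thus False using nz v0 by (simp add: divide_le_0_iff)
  qed
  moreover have "y \<noteq> 0" using x m(1) by (auto simp: y_def)
  ultimately show ?thesis by blast
qed

text \<open>A nonzero \<open>y\<close> orthogonal to the kernel determines \<phi>, since
  \<open>\<phi> y *\<^sub>C x - \<phi> x *\<^sub>C y\<close> always lies in the kernel.\<close>

lemma riesz_representation:
  fixes \<phi> :: "'a::complex_hilbert \<Rightarrow> complex"
  assumes "bounded_linear \<phi>" and sc: "\<And>c x. \<phi> (c *\<^sub>C x) = c * \<phi> x"
  shows "\<exists>z. \<forall>x. \<phi> x = cinner z x"
proof (cases "\<forall>x. \<phi> x = 0")
  case True
  thus ?thesis by (intro exI[of _ 0]) simp
next
  case False
  interpret bounded_linear \<phi> by fact
  define M where "M = {x. \<phi> x = 0}"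
  have "csubspace M"
    by (auto simp: csubspace_def subspace_def M_def add scale zero sc)
  moreover have "closed M"
    unfolding M_def by (intro closed_Collect_eq continuous_on continuous_on_const continuous_on_id)
  moreover have "M \<noteq> UNIV" using False by (auto simp: M_def)
  ultimately obtain y where y: "y \<noteq> 0" "\<And>v. \<phi> v = 0 \<Longrightarrow> cinner y v = 0"
    using exists_orthogonal[of M] by (auto simp: M_def)
  have "\<phi> x = cinner ((cnj (\<phi> y) / of_real ((norm y)\<^sup>2)) *\<^sub>C y) x" for x
  proof -
    have "\<phi> (\<phi> y *\<^sub>C x - \<phi> x *\<^sub>C y) = 0" by (simp add: diff sc)
    from y(2)[OF this] have "\<phi> y * cinner y x = \<phi> x * of_real ((norm y)\<^sup>2)"
      by (simp add: cinner_simps cinner_self)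
    thus ?thesis using y(1) by (simp add: cinner_scaleC_left field_simps)
  qed
  thus ?thesis by blast
qed

text \<open>The definite description in \<open>cadjoint\<close> says nothing unless a representing
  vector exists; Riesz supplies one because \<open>A\<close> is bounded.\<close>

lemma cinner_bounded_self_adjoint:
  fixes A :: "'a::complex_hilbert \<Rightarrow> 'a"
  assumes A: "bounded_clinear A" and adj: "cadjoint UNIV A = A"
  shows "cinner y (A x) = cinner (A y) x"
proof -
  have "bounded_linear (\<lambda>x. cinner y (A x))"
    using bounded_linear_compose[OF bounded_bilinear.bounded_linear_right[OF bounded_bilinear_cinner]
        bounded_clinear_bounded_linear[OF A]] .
  from riesz_representation[OF this] obtain z where z: "\<And>x. cinner y (A x) = cinner z x"
    by (auto simp: bounded_clinear_scaleC[OF A] cinner_scaleC_right)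
  have "cadjoint UNIV A y = z"
    unfolding cadjoint_def
    by (rule the_equality) (auto simp: z intro: eq_if_cinner_eq_on_dense[of UNIV])
  thus ?thesis using adj z by simp
qed

section \<open>Self-adjoint operators and their resolvents\<close>

lemma has_vector_derivative_at_iff_quotient:
  "(f has_vector_derivative f') (at x) \<longleftrightarrow> ((\<lambda>h. (f (x + h) - f x) /\<^sub>R h) \<longlongrightarrow> f') (at 0)"
proof -
  have "norm (f (x + h) - f x - h *\<^sub>R f') / norm h = norm ((f (x + h) - f x) /\<^sub>R h - f')"
    if "h \<noteq> 0" for h :: real
  proof -
    have "(f (x + h) - f x) /\<^sub>R h - f' = (f (x + h) - f x - h *\<^sub>R f') /\<^sub>R h"
      using that by (simp add: scaleR_diff_right)
    thus ?thesis by (simp add: divide_inverse_commute)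
  qed
  hence "((\<lambda>h. norm (f (x + h) - f x - h *\<^sub>R f') / norm h) \<longlongrightarrow> 0) (at 0) \<longleftrightarrow>
      ((\<lambda>h. norm ((f (x + h) - f x) /\<^sub>R h - f')) \<longlongrightarrow> 0) (at 0)"
    by (intro tendsto_cong) (auto simp: eventually_at_filter)
  thus ?thesis
    by (simp add: has_vector_derivative_def has_derivative_at bounded_linear_scaleR_left
        tendsto_norm_zero_iff LIM_zero_iff)
qed

text \<open>Applied to complex-valued pairings, this inequality takes the place of integrating the
  variation-of-constants formula. The interval is symmetric because groups run in both directions of
  time.\<close>

lemma norm_diff_le_vector_derivative_bound:
  fixes f :: "real \<Rightarrow> 'b::real_normed_vector"
  assumes "\<And>x. \<bar>x\<bar> \<le> T \<Longrightarrow> (f has_vector_derivative f' x) (at x)"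
    and "\<And>x. \<bar>x\<bar> \<le> T \<Longrightarrow> norm (f' x) \<le> B" and "\<bar>t\<bar> \<le> T"
  shows "norm (f t - f 0) \<le> B * \<bar>t\<bar>"
proof -
  have "norm (f t - f 0) \<le> B * norm (t - 0)"
  proof (rule differentiable_bound[where S = "{-T..T}" and f' = "\<lambda>x h. h *\<^sub>R f' x"])
    show "onorm (\<lambda>h. h *\<^sub>R f' x) \<le> B" if "x \<in> {-T..T}" for x
    proof (rule onorm_bound)
      have b: "norm (f' x) \<le> B" using that by (intro assms(2)) auto
      show "0 \<le> B" using b norm_ge_zero[of "f' x"] by (rule order_trans[rotated])
      show "norm (h *\<^sub>R f' x) \<le> B * norm h" for h
        using mult_right_mono[OF b, of "norm h"] by (simp add: mult.commute)
    qed
  next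
    show "(f has_derivative (\<lambda>h. h *\<^sub>R f' x)) (at x within {-T..T})" if "x \<in> {-T..T}" for x
      using assms(1)[of x] that
      by (auto simp: has_vector_derivative_def intro: has_derivative_at_withinI)
  qed (use assms(3) in auto)
  thus ?thesis by simp
qed

text \<open>Self-adjointness split into two inclusions without mentioning the adjoint:
  \<open>sym\<close> says that the adjoint extends \<open>H\<close>, \<open>maximal\<close> that it
  goes no further.\<close>

locale selfadj =
  fixes D :: "'a::complex_hilbert set" and H :: "'a \<Rightarrow> 'a"
  assumes subsp: "csubspace D" and dense: "closure D = UNIV" and lin: "clinear_on D H"
    and sym: "x \<in> D \<Longrightarrow> y \<in> D \<Longrightarrow> cinner y (H x) = cinner (H y) x"
    and maximal: "(\<And>x. x \<in> D \<Longrightarrow> cinner y (H x) = cinner z x) \<Longrightarrow> y \<in> D \<and> H y = z"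
begin

lemmas D_zero [simp] = csubspaceD(1)[OF subsp]
lemmas D_add = csubspaceD(2)[OF subsp]
lemmas D_diff = csubspaceD(3)[OF subsp]
lemmas D_scale = csubspaceD(4)[OF subsp]

lemma H_add: "x \<in> D \<Longrightarrow> y \<in> D \<Longrightarrow> H (x + y) = H x + H y"
  using lin by (simp add: clinear_on_def)

lemma H_scale: "x \<in> D \<Longrightarrow> H (c *\<^sub>C x) = c *\<^sub>C H x"
  using lin by (simp add: clinear_on_def)

lemma H_diff: "x \<in> D \<Longrightarrow> y \<in> D \<Longrightarrow> H (x - y) = H x - H y"
  using H_add[of x "(-1) *\<^sub>C y"] H_scale[of y "-1"] D_scale[of y "-1"]
  by (simp add: scaleC_minus_left)

text \<open>Symmetry survives the limit, so \<open>l\<close> and \<open>m\<close> meet the premise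
  of \<open>maximal\<close>.\<close>

lemma closed_graph:
  assumes "\<And>n. x n \<in> D" "x \<longlonglongrightarrow> l" "(\<lambda>n. H (x n)) \<longlonglongrightarrow> m"
  shows "l \<in> D \<and> H l = m"
proof (rule maximal)
  fix w assume w: "w \<in> D"
  have "(\<lambda>n. cinner (x n) (H w)) \<longlonglongrightarrow> cinner l (H w)"
    by (intro tendsto_intros assms)
  moreover have "(\<lambda>n. cinner (H (x n)) w) \<longlonglongrightarrow> cinner m w"
    by (intro tendsto_intros assms)
  ultimately show "cinner l (H w) = cinner m w"
    using sym[OF w assms(1)] LIMSEQ_unique by auto
qed

text \<open>The cross term vanishes because symmetry makes \<open>cinner (H x) x\<close>
  real.\<close>

lemma norm_shift:
  assumes x: "x \<in> D"
  shows "(norm (H x - (\<i> * of_real r) *\<^sub>C x))\<^sup>2 = (norm (H x))\<^sup>2 + r\<^sup>2 * (norm x)\<^sup>2"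
proof -
  have "cinner (H x) x = cnj (cinner (H x) x)"
    by (metis sym[OF x x] cinner_commute)
  hence "Im (cinner (H x) x) = 0"
    by (metis Reals_cnj_iff complex_is_Real_iff)
  thus ?thesis
    by (simp add: norm_power2_diff cinner_scaleC_right norm_scaleC norm_mult power_mult_distrib)
qed

lemma norm_le_shift:
  assumes "x \<in> D"
  shows "\<bar>r\<bar> * norm x \<le> norm (H x - (\<i> * of_real r) *\<^sub>C x)"
proof -
  have "(\<bar>r\<bar> * norm x)\<^sup>2 \<le> (norm (H x - (\<i> * of_real r) *\<^sub>C x))\<^sup>2"
    unfolding norm_shift[OF assms] by (simp add: power_mult_distrib)
  thus ?thesis by (rule power2_le_imp_le) simp
qed

lemma shift_diff:
  "x \<in> D \<Longrightarrow> y \<in> D \<Longrightarrow> H (x - y) - c *\<^sub>C (x - y) = (H x - c *\<^sub>C x) - (H y - c *\<^sub>C y)"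
  by (simp add: H_diff scaleC_diff_right)

text \<open>The range is closed, since \<open>norm_le_shift\<close> makes the preimages of a
  convergent sequence Cauchy and the graph is closed. It is everything, since by
  \<open>maximal\<close> a nonzero vector orthogonal to it would be an eigenvector with a non-real
  eigenvalue.\<close>

lemma surj_shift:
  assumes r: "r \<noteq> 0"
  shows "\<exists>x\<in>D. H x - (\<i> * of_real r) *\<^sub>C x = g"
proof -
  define h where "h = (\<lambda>x. H x - (\<i> * of_real r) *\<^sub>C x)"
  have h_add: "h x + h y = h (x + y)" if "x \<in> D" "y \<in> D" for x y
    using that by (simp add: h_def H_add scaleC_add_right)
  have h_scale: "c *\<^sub>C h x = h (c *\<^sub>C x)" if "x \<in> D" for x c
    using that by (simp add: h_def H_scale scaleC_simps mult.commute)
  have sub: "csubspace (h ` D)"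
    unfolding csubspace_def subspace_def
  proof (intro conjI ballI allI)
    show "0 \<in> h ` D"
      using h_scale[of 0 0] by (auto intro!: image_eqI[of _ _ 0])
    show "u + v \<in> h ` D" if "u \<in> h ` D" "v \<in> h ` D" for u v
      using that by (auto simp: h_add D_add)
    show "c *\<^sub>C u \<in> h ` D" if "u \<in> h ` D" for u c
      using that by (auto simp: h_scale D_scale)
    thus "c *\<^sub>R u \<in> h ` D" if "u \<in> h ` D" for u c
      using that by (metis scaleC_of_real)
  qed
  have "closed (h ` D)"
    unfolding closed_sequential_limits
  proof (intro allI impI, elim conjE)
    fix y l assume y: "\<forall>n. y n \<in> h ` D" and l: "y \<longlonglongrightarrow> l"
    have "\<forall>n. \<exists>x. x \<in> D \<and> y n = h x" using y by (auto simp: image_iff)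
    then obtain x where x: "\<And>n. x n \<in> D" "\<And>n. y n = h (x n)"
      by metis
    have "Cauchy x"
    proof (rule metric_CauchyI)
      fix e :: real assume "e > 0"
      hence "e * \<bar>r\<bar> > 0" using r by simp
      then obtain N where N: "\<And>m n. m \<ge> N \<Longrightarrow> n \<ge> N \<Longrightarrow> dist (y m) (y n) < e * \<bar>r\<bar>"
        using LIMSEQ_imp_Cauchy[OF l] unfolding Cauchy_def by blast
      show "\<exists>N. \<forall>m\<ge>N. \<forall>n\<ge>N. dist (x m) (x n) < e"
      proof (intro exI allI impI)
        fix m n assume "m \<ge> N" "n \<ge> N"
        from N[OF this] have "norm (h (x m) - h (x n)) < e * \<bar>r\<bar>"
          by (simp add: dist_norm x(2))
        moreover have "\<bar>r\<bar> * norm (x m - x n) \<le> norm (h (x m) - h (x n))"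
          using norm_le_shift[OF D_diff[OF x(1) x(1)], of r m n]
          by (simp add: h_def shift_diff x(1))
        ultimately have "\<bar>r\<bar> * norm (x m - x n) < \<bar>r\<bar> * e" by (simp add: mult.commute)
        thus "dist (x m) (x n) < e" using r by (simp add: dist_norm)
      qed
    qed
    then obtain u where u: "x \<longlonglongrightarrow> u" by (auto simp: Cauchy_convergent_iff convergent_def)
    have "(\<lambda>n. y n + (\<i> * of_real r) *\<^sub>C x n) \<longlonglongrightarrow> l + (\<i> * of_real r) *\<^sub>C u"
      by (intro tendsto_intros u l)
    hence "(\<lambda>n. H (x n)) \<longlonglongrightarrow> l + (\<i> * of_real r) *\<^sub>C u"
      by (simp add: x(2) h_def)
    from closed_graph[OF x(1) u this] show "l \<in> h ` D"
      by (auto simp: h_def intro!: image_eqI[of _ _ u])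
  qed
  moreover have "y = 0" if y: "\<forall>v\<in>h ` D. cinner y v = 0" for y
  proof -
    have "y \<in> D \<and> H y = (- \<i> * of_real r) *\<^sub>C y"
      using y by (intro maximal) (auto simp: h_def cinner_simps)
    hence "(norm (H y))\<^sup>2 + (-r)\<^sup>2 * (norm y)\<^sup>2 = 0"
      using norm_shift[of y "-r"] by simp
    thus "y = 0" using r by (auto simp: add_nonneg_eq_0_iff)
  qed
  ultimately have "h ` D = UNIV" using exists_orthogonal[OF sub] by blast
  hence "g \<in> h ` D" by simp
  thus ?thesis by (auto simp: h_def)
qed

lemma inj_on_shift:
  assumes "r \<noteq> 0"
  shows "inj_on (\<lambda>x. H x - (\<i> * of_real r) *\<^sub>C x) D"
proof (rule inj_onI)
  fix x y assume "x \<in> D" "y \<in> D" "H x - (\<i> * of_real r) *\<^sub>C x = H y - (\<i> * of_real r) *\<^sub>C y"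
  hence "\<bar>r\<bar> * norm (x - y) \<le> 0"
    using norm_le_shift[OF D_diff[of x y], of r] by (simp add: shift_diff)
  thus "x = y" using assms by (simp add: mult_le_0_iff)
qed

text \<open>\<open>Res r = (H - \<i>r)\<^sup>-\<^sup>1\<close>, meaningful for \<open>r \<noteq> 0\<close> only.\<close>

definition Res :: "real \<Rightarrow> 'a \<Rightarrow> 'a" where
  "Res r = inv_into D (\<lambda>x. H x - (\<i> * of_real r) *\<^sub>C x)"

context
  fixes r :: real
  assumes r: "r \<noteq> 0"
begin

lemma Res_in: "Res r g \<in> D"
  unfolding Res_def using surj_shift[OF r, of g] by (intro inv_into_into) auto

lemma Res_eq: "H (Res r g) - (\<i> * of_real r) *\<^sub>C Res r g = g"
  unfolding Res_def using surj_shift[OF r, of g] by (intro f_inv_into_f) auto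

lemma H_Res: "H (Res r g) = g + (\<i> * of_real r) *\<^sub>C Res r g"
  using Res_eq[of g] by (simp add: diff_eq_eq)

lemma Res_shift: "x \<in> D \<Longrightarrow> Res r (H x - (\<i> * of_real r) *\<^sub>C x) = x"
  unfolding Res_def using inj_on_shift[OF r] by (rule inv_into_f_f)

lemma Res_add: "Res r (f + g) = Res r f + Res r g"
proof -
  have "H (Res r f + Res r g) - (\<i> * of_real r) *\<^sub>C (Res r f + Res r g) = f + g"
    by (simp add: H_add Res_in H_Res scaleC_add_right)
  thus ?thesis using Res_shift[OF D_add[OF Res_in Res_in], of f g] by simp
qed

lemma Res_scale: "Res r (c *\<^sub>C f) = c *\<^sub>C Res r f"
proof -
  have "H (c *\<^sub>C Res r f) - (\<i> * of_real r) *\<^sub>C (c *\<^sub>C Res r f) = c *\<^sub>C f"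
    by (simp add: H_scale Res_in H_Res scaleC_add_right scaleC_scaleC mult.commute)
  thus ?thesis using Res_shift[OF D_scale[OF Res_in], of c f] by simp
qed

lemma norm_Res: "\<bar>r\<bar> * norm (Res r g) \<le> norm g"
  using norm_le_shift[OF Res_in, of r g] by (simp add: Res_eq)

lemma bounded_clinear_Res: "bounded_clinear (Res r)"
  using norm_Res r
  by (intro bounded_clinearI[where K = "1 / \<bar>r\<bar>"] Res_add Res_scale)
    (simp add: field_simps)

text \<open>Substitute \<open>y = (H + \<i> r) u\<close> and \<open>g = (H - \<i> r) v\<close>. The
  adjoint lands on the opposite sign, so adding both signs of \<open>r\<close> will produce a
  self-adjoint approximation.\<close>

lemma cinner_Res: "cinner y (Res r g) = cinner (Res (-r) y) g"
proof -
  define u v where "u = Res (-r) y" and "v = Res r g"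
  have uv: "u \<in> D" "v \<in> D" "y = H u + (\<i> * of_real r) *\<^sub>C u" "g = H v - (\<i> * of_real r) *\<^sub>C v"
    unfolding u_def v_def using r selfadj.Res_eq[OF selfadj_axioms, of "-r" y]
      selfadj.Res_in[OF selfadj_axioms, of "-r"]
    by (simp_all add: Res_in Res_eq scaleC_minus_left)
  have "cinner y v = cinner u g"
    using sym[OF uv(2,1)] by (simp add: uv(3,4) cinner_simps)
  thus ?thesis by (simp add: u_def v_def)
qed

end

text \<open>The first resolvent identity: \<open>H - \<i> r\<close> sends both sides to the same
  vector.\<close>

lemma Res_diff:
  assumes "r \<noteq> 0" "s \<noteq> 0"
  shows "Res r g - Res s g = (\<i> * of_real (r - s)) *\<^sub>C Res r (Res s g)"
proof -
  have "H (Res r g - Res s g) - (\<i> * of_real r) *\<^sub>C (Res r g - Res s g) =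
      (\<i> * of_real (r - s)) *\<^sub>C Res s g"
    using assms by (simp add: H_diff Res_in H_Res scaleC_diff_right scaleC_diff_left right_diff_distrib)
  thus ?thesis
    using Res_shift[OF assms(1) D_diff[OF Res_in Res_in], of r s g g] assms
    by (simp add: Res_scale)
qed

text \<open>Exchanging \<open>r\<close> and \<open>s\<close> in the resolvent identity only changes
  the sign of its left side, and the factor \<open>r - s\<close> can be cancelled.\<close>

lemma Res_commute:
  assumes "r \<noteq> 0" "s \<noteq> 0"
  shows "Res r (Res s g) = Res s (Res r g)"
proof (cases "r = s")
  case False
  have "(\<i> * of_real (r - s)) *\<^sub>C Res r (Res s g) = Res r g - Res s g"
    by (rule Res_diff[OF assms, symmetric])
  also have "\<dots> = - ((\<i> * of_real (s - r)) *\<^sub>C Res s (Res r g))"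
    unfolding Res_diff[OF assms(2,1), symmetric] by simp
  also have "\<dots> = (\<i> * of_real (r - s)) *\<^sub>C Res s (Res r g)"
    unfolding scaleC_minus_left[symmetric] by (simp add: algebra_simps)
  finally have "(\<i> * of_real (r - s)) *\<^sub>C (Res r (Res s g) - Res s (Res r g)) = 0"
    by (simp add: scaleC_diff_right)
  thus ?thesis using False by simp
qed simp

end

section \<open>Self-adjointness of bounded symmetric operators, of the given operator and of its
  real multiples\<close>

lemma selfadj_bounded:
  fixes B :: "'a::complex_hilbert \<Rightarrow> 'a"
  assumes B: "bounded_clinear B" and sym: "\<And>x y. cinner y (B x) = cinner (B y) x"
  shows "selfadj UNIV B"
proof
  show "clinear_on UNIV B"
    using B by (auto simp: clinear_on_def bounded_clinear_def linear_simps)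
  show "y \<in> UNIV \<and> B y = z" if "\<And>x. x \<in> UNIV \<Longrightarrow> cinner y (B x) = cinner z x" for y z
    using that by (intro conjI UNIV_I eq_if_cinner_eq_on_dense[of UNIV]) (simp_all flip: sym)
qed (simp_all add: csubspace_def sym[symmetric])

lemma selfadj_of_self_adjoint:
  fixes H :: "'a::complex_hilbert \<Rightarrow> 'a"
  assumes "csubspace D" "closure D = UNIV" "clinear_on D H" "self_adjoint D H"
  shows "selfadj D H"
proof
  have maximal: "y \<in> D \<and> H y = z" if yz: "\<And>x. x \<in> D \<Longrightarrow> cinner y (H x) = cinner z x" for y z
  proof -
    have "y \<in> cadjoint_dom D H" using yz by (auto simp: cadjoint_dom_def)
    hence "y \<in> D" using assms(4) by (simp add: self_adjoint_def)
    moreover have "cadjoint D H y = z"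
      unfolding cadjoint_def
      by (rule the_equality) (auto simp: yz intro: eq_if_cinner_eq_on_dense[OF assms(2)])
    ultimately show ?thesis using assms(4) by (simp add: self_adjoint_def)
  qed
  thus "y \<in> D \<and> H y = z" if "\<And>x. x \<in> D \<Longrightarrow> cinner y (H x) = cinner z x" for y z
    using that by blast
  show "cinner y (H x) = cinner (H y) x" if "x \<in> D" "y \<in> D" for x y
  proof -
    have "y \<in> cadjoint_dom D H" using assms(4) that by (simp add: self_adjoint_def)
    then obtain z where z: "\<And>x. x \<in> D \<Longrightarrow> cinner y (H x) = cinner z x"
      by (auto simp: cadjoint_dom_def)
    thus ?thesis using maximal[OF z] that by auto
  qed
qed fact+

lemma (in selfadj) selfadj_scaleR:
  assumes a: "a \<noteq> 0"
  shows "selfadj D (\<lambda>x. of_real a *\<^sub>C H x)"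
proof
  show "clinear_on D (\<lambda>x. of_real a *\<^sub>C H x)"
    using lin by (auto simp: clinear_on_def scaleC_simps mult.commute)
  show "cinner y (of_real a *\<^sub>C H x) = cinner (of_real a *\<^sub>C H y) x" if "x \<in> D" "y \<in> D" for x y
    using sym[OF that] by (simp add: cinner_simps)
  show "y \<in> D \<and> of_real a *\<^sub>C H y = z"
    if yz: "\<And>x. x \<in> D \<Longrightarrow> cinner y (of_real a *\<^sub>C H x) = cinner z x" for y z
  proof -
    have "y \<in> D \<and> H y = of_real (inverse a) *\<^sub>C z"
    proof (rule maximal)
      fix x assume "x \<in> D"
      from yz[OF this] show "cinner y (H x) = cinner (of_real (inverse a) *\<^sub>C z) x"
        using a by (simp add: cinner_simps field_simps)
    qed
    thus ?thesis using a by (simp add: scaleC_scaleC)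
  qed
qed (fact subsp dense)+

section \<open>Unitary groups\<close>

lemma has_vector_derivative_cinner:
  assumes "(f has_vector_derivative f') (at x)" "(g has_vector_derivative g') (at x)"
  shows "((\<lambda>x. cinner (f x) (g x)) has_vector_derivative (cinner (f x) g' + cinner f' (g x))) (at x)"
  by (rule bounded_bilinear.has_vector_derivative[OF bounded_bilinear_cinner assms])

text \<open>The group is an assumption here, so that the same estimates apply to exponentials of
  bounded operators before Stone's theorem is available and to its result afterwards.\<close>

locale ugroup = selfadj +
  fixes U :: "real \<Rightarrow> 'a \<Rightarrow> 'a"
  assumes group: "sc_unitary_group U" and gen: "is_generator U D (\<lambda>f. \<i> *\<^sub>C H f)"
begin

lemma U_bounded_clinear: "bounded_clinear (U t)"
  using group by (simp add: sc_unitary_group_def unitary_def)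

lemma U_scale: "U t (c *\<^sub>C f) = c *\<^sub>C U t f"
  by (rule bounded_clinear_scaleC[OF U_bounded_clinear])

lemma U_cinner: "cinner (U t f) (U t g) = cinner f g"
  using group by (simp add: sc_unitary_group_def unitary_def)

lemma norm_U [simp]: "norm (U t f) = norm f"
  by (simp add: norm_eq_sqrt_cinner U_cinner)

lemma U_0 [simp]: "U 0 f = f"
  using group by (simp add: sc_unitary_group_def)

lemma U_add: "U (s + t) f = U s (U t f)"
  using group by (simp add: sc_unitary_group_def)

lemma U_inverse [simp]: "U t (U (-t) f) = f"
  by (simp flip: U_add)

lemma U_diff: "U t (f - g) = U t f - U t g"
  using bounded_clinear_bounded_linear[OF U_bounded_clinear] by (simp add: linear_simps)

lemma norm_U_diff [simp]: "norm (U t f - U t g) = norm (f - g)"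
  by (simp flip: U_diff)

lemma U_continuous: "continuous_on UNIV (\<lambda>t. U t f)"
  using group by (simp add: sc_unitary_group_def)

lemma tendsto_U: "(g \<longlongrightarrow> l) F \<Longrightarrow> ((\<lambda>x. U t (g x)) \<longlongrightarrow> U t l) F"
  by (rule bounded_linear.tendsto[OF bounded_clinear_bounded_linear[OF U_bounded_clinear]])

lemma U_quotient:
  assumes "f \<in> D"
  shows "((\<lambda>h. (U h f - f) /\<^sub>R h) \<longlongrightarrow> \<i> *\<^sub>C H f) (at 0)"
proof -
  have "f \<in> deriv0_dom (at 0) U" and d: "deriv0 (at 0) U f = \<i> *\<^sub>C H f"
    using gen assms by (auto simp: is_generator_def)
  then obtain l where l: "((\<lambda>h. (U h f - f) /\<^sub>R h) \<longlongrightarrow> l) (at 0)"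
    by (auto simp: deriv0_dom_def)
  thus ?thesis using d tendsto_Lim[OF _ l] by (simp add: deriv0_def)
qed

lemma U_quotient_at:
  assumes "f \<in> D"
  shows "((\<lambda>h. (U h (U t f) - U t f) /\<^sub>R h) \<longlongrightarrow> \<i> *\<^sub>C U t (H f)) (at 0)"
proof -
  have "(U h (U t f) - U t f) /\<^sub>R h = U t ((U h f - f) /\<^sub>R h)" for h
    using U_scale[of t "of_real (inverse h)" "U h f - f"]
    unfolding scaleC_of_real by (simp add: U_diff add.commute flip: U_add)
  thus ?thesis using tendsto_U[OF U_quotient[OF assms], of t] by (simp add: U_scale)
qed

text \<open>The difference quotients at \<open>U t f\<close> converge, and the domain of the
  generator is exactly \<open>D\<close>.\<close>

lemma U_D: "f \<in> D \<Longrightarrow> U t f \<in> D"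
  using U_quotient_at[of f t] gen by (auto simp: is_generator_def deriv0_dom_def)

lemma H_U:
  assumes "f \<in> D"
  shows "H (U t f) = U t (H f)"
proof -
  have "\<i> *\<^sub>C H (U t f) = \<i> *\<^sub>C U t (H f)"
    using tendsto_unique[OF _ U_quotient[OF U_D[OF assms]] U_quotient_at[OF assms]] by simp
  hence "(- \<i>) *\<^sub>C \<i> *\<^sub>C H (U t f) = (- \<i>) *\<^sub>C \<i> *\<^sub>C U t (H f)" by simp
  thus ?thesis by (simp add: scaleC_scaleC)
qed

lemma U_vector_derivative:
  assumes "f \<in> D"
  shows "((\<lambda>t. U t f) has_vector_derivative \<i> *\<^sub>C H (U t f)) (at t)"
  unfolding has_vector_derivative_at_iff_quotient H_U[OF assms]
  using U_quotient_at[OF assms, of t] by (simp add: add.commute[of t] U_add)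

text \<open>The deviation \<open>y\<close> of \<open>u\<close> from the orbit of its initial value is paired with an orbit \<open>U \<tau> v\<close>;
  by self-adjointness only \<open>r\<close> contributes to the derivative of the pairing.\<close>

lemma duhamel_bound:
  assumes uD: "\<And>\<tau>. u \<tau> \<in> D"
    and du: "\<And>\<tau>. (u has_vector_derivative (\<i> *\<^sub>C H (u \<tau>) + r \<tau>)) (at \<tau>)"
    and rM: "\<And>\<tau>. \<bar>\<tau>\<bar> \<le> T \<Longrightarrow> norm (r \<tau>) \<le> M" and t: "\<bar>t\<bar> \<le> T"
  shows "norm (u t - U t (u 0)) \<le> M * \<bar>t\<bar>"
proof -
  define y where "y = (\<lambda>\<tau>. u \<tau> - U \<tau> (u 0))"
  have yD: "y \<tau> \<in> D" for \<tau> by (simp add: y_def D_diff uD U_D)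
  \<comment> \<open>With this \<open>v\<close> the pairing at time \<open>t\<close> is the squared
    norm of \<open>y t\<close>, while at time 0 it vanishes; one factor
    \<open>norm v = norm (y t)\<close> then cancels.\<close>
  define v where "v = U (- t) (y t)"
  have vD: "v \<in> D" by (simp add: v_def U_D yD)
  have dy: "(y has_vector_derivative (\<i> *\<^sub>C H (y \<tau>) + r \<tau>)) (at \<tau>)" for \<tau>
    unfolding y_def
    using has_vector_derivative_diff[OF du[of \<tau>] U_vector_derivative[OF uD[of 0], of \<tau>]]
    by (simp add: H_diff uD U_D scaleC_diff_right algebra_simps)
  have "((\<lambda>\<tau>. cinner (U \<tau> v) (y \<tau>)) has_vector_derivative cinner (U \<tau> v) (r \<tau>)) (at \<tau>)" for \<tau>
    using has_vector_derivative_cinner[OF U_vector_derivative[OF vD] dy[of \<tau>]]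
    by (simp add: cinner_simps sym[OF yD U_D[OF vD]])
  moreover have "cmod (cinner (U \<tau> v) (r \<tau>)) \<le> norm v * M" if "\<bar>\<tau>\<bar> \<le> T" for \<tau>
    using cmod_cinner_le[of "U \<tau> v" "r \<tau>"] mult_left_mono[OF rM[OF that], of "norm v"] by simp
  ultimately have "norm (cinner (U t v) (y t) - cinner (U 0 v) (y 0)) \<le> (norm v * M) * \<bar>t\<bar>"
    using t by (rule norm_diff_le_vector_derivative_bound)
  moreover have "norm v = norm (y t)" and "U t v = y t" and "y 0 = 0"
    by (simp_all add: v_def y_def)
  ultimately have "norm (y t) * norm (y t) \<le> norm (y t) * (M * \<bar>t\<bar>)"
    by (simp add: cinner_self power2_eq_square mult.assoc norm_mult)
  moreover have "0 \<le> M * \<bar>t\<bar>"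
    using order_trans[OF norm_ge_zero rM[OF t]] by simp
  ultimately show ?thesis
    unfolding y_def[symmetric] by (cases "y t = 0") (auto simp: y_def)
qed

end

section \<open>Groups and their generators: uniqueness and recognition\<close>

lemma eq_of_eq_on_dense:
  fixes V W :: "'a::real_normed_vector \<Rightarrow> 'b::t2_space"
  assumes "closure D = UNIV" "\<And>x. x \<in> D \<Longrightarrow> V x = W x"
    "continuous_on UNIV V" "continuous_on UNIV W"
  shows "V = W"
proof
  fix x
  have "closed {x. V x = W x}" using assms(3,4) by (rule closed_Collect_eq)
  moreover have "D \<subseteq> {x. V x = W x}" using assms(2) by auto
  ultimately have "closure D \<subseteq> {x. V x = W x}" by (rule closure_minimal[rotated])
  thus "V x = W x" using assms(1) by auto
qed

text \<open>An orbit of \<open>V\<close> starting in \<open>D\<close> solves the evolution equation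
  of \<open>U\<close> with zero error, so the Duhamel bound makes it an orbit of \<open>U\<close>;
  density and continuity do the rest.\<close>

lemma ugroup_unique:
  assumes "ugroup D H U" "ugroup D H V"
  shows "U = V"
proof
  fix t
  interpret U: ugroup D H U by fact
  interpret V: ugroup D H V by fact
  have cont: "bounded_clinear W \<Longrightarrow> continuous_on UNIV W" for W :: "'a \<Rightarrow> 'a"
    by (simp add: bounded_clinear_def linear_continuous_on)
  have "U t f = V t f" if "f \<in> D" for f
  proof -
    have "norm (V t f - U t (V 0 f)) \<le> 0 * \<bar>t\<bar>"
      by (rule U.duhamel_bound[where r = "\<lambda>_. 0" and T = "\<bar>t\<bar>"])
        (use V.U_vector_derivative[OF that] V.U_D[OF that] in auto)
    thus ?thesis by simp
  qed
  thus "U t = V t"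
    using cont[OF U.U_bounded_clinear] cont[OF V.U_bounded_clinear]
    by (intro eq_of_eq_on_dense[OF U.dense]) auto
qed

lemma (in ugroup) unitary_group_gen_eq: "unitary_group_gen D (\<lambda>f. \<i> *\<^sub>C H f) = U"
  unfolding unitary_group_gen_def
proof (rule the_equality)
  fix V assume "sc_unitary_group V \<and> is_generator V D (\<lambda>f. \<i> *\<^sub>C H f)"
  hence "ugroup D H V"
    by (intro ugroup.intro ugroup_axioms.intro selfadj_axioms) auto
  thus "V = U" by (rule ugroup_unique) (rule ugroup_axioms)
qed (use group gen in auto)

text \<open>A symmetric extension of a self-adjoint operator is trivial, so it suffices to compute the
  generator on the domain.\<close>

lemma (in selfadj) ugroupI:
  assumes group: "sc_unitary_group U"
    and deriv: "\<And>f. f \<in> D \<Longrightarrow> ((\<lambda>h. (U h f - f) /\<^sub>R h) \<longlongrightarrow> \<i> *\<^sub>C H f) (at 0)"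
  shows "ugroup D H U"
proof
  have U: "cinner (U t f) (U t g) = cinner f g" "U (s + t) f = U s (U t f)" "U 0 f = f" for s t f g
    using group by (simp_all add: sc_unitary_group_def unitary_def)
  have "y \<in> D" if y: "y \<in> deriv0_dom (at 0) U" for y
  proof -
    obtain l where l: "((\<lambda>h. (U h y - y) /\<^sub>R h) \<longlongrightarrow> l) (at 0)"
      using y by (auto simp: deriv0_dom_def)
    have neg: "filterlim uminus (at (0::real)) (at 0)"
      by (auto simp: filterlim_at eventually_at_filter intro!: tendsto_eq_intros)
    have "cinner y (H x) = cinner ((- \<i>) *\<^sub>C l) x" if x: "x \<in> D" for x
    proof -
      have a: "((\<lambda>h. cinner y ((U h x - x) /\<^sub>R h)) \<longlongrightarrow> cinner y (\<i> *\<^sub>C H x)) (at 0)"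
        by (intro tendsto_intros deriv x)
      have b: "((\<lambda>h. - cinner ((U (-h) y - y) /\<^sub>R (-h)) x) \<longlongrightarrow> - cinner l x) (at 0)"
        by (intro tendsto_intros filterlim_compose[OF l neg])
      \<comment> \<open>The adjoint of \<open>U h\<close> is \<open>U (-h)\<close>, so the quotient
        moves from \<open>x\<close> to \<open>y\<close> with the sign of \<open>h\<close> reversed;
        in the limit \<open>y\<close> meets the premise of \<open>maximal\<close>.\<close>
      have "cinner y (U h x) = cinner (U (-h) y) x" for h
        using U(1)[of "h" "U (-h) y" x] U(2)[of h "-h" y] U(3) by simp
      hence "cinner y ((U h x - x) /\<^sub>R h) = - cinner ((U (-h) y - y) /\<^sub>R (-h)) x" for h
        by (simp add: cinner_scaleR_left cinner_scaleR_right cinner_simps)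
      with a b have "cinner y (\<i> *\<^sub>C H x) = - cinner l x"
        using tendsto_unique[of "at (0::real)"] by simp
      hence "\<i> * (\<i> * cinner y (H x)) = \<i> * (- cinner l x)" by (simp add: cinner_simps)
      thus ?thesis by (simp add: cinner_simps)
    qed
    from maximal[OF this] show "y \<in> D" by blast
  qed
  moreover have "D \<subseteq> deriv0_dom (at 0) U" using deriv by (auto simp: deriv0_dom_def)
  ultimately show "is_generator U D (\<lambda>f. \<i> *\<^sub>C H f)"
    using deriv by (auto simp: is_generator_def deriv0_def intro!: tendsto_Lim)
qed (fact group)

section \<open>Exponentials of bounded operators\<close>

lemma bounded_linear_funpow:
  fixes A :: "'a::real_normed_vector \<Rightarrow> 'a"
  assumes "bounded_linear A"
  shows "bounded_linear (A ^^ k)"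
proof (induction k)
  case (Suc k)
  from bounded_linear_compose[OF assms Suc] show ?case by (simp add: o_def)
qed (simp add: id_def bounded_linear_ident)

lemma norm_funpow_le:
  fixes A :: "'a::real_normed_vector \<Rightarrow> 'a"
  assumes A: "bounded_linear A"
  shows "norm ((A ^^ k) f) \<le> onorm A ^ k * norm f"
proof (induction k)
  case (Suc k)
  have "norm ((A ^^ Suc k) f) \<le> onorm A * norm ((A ^^ k) f)"
    using onorm[OF A] by simp
  also have "\<dots> \<le> onorm A * (onorm A ^ k * norm f)"
    by (rule mult_left_mono[OF Suc onorm_pos_le[OF A]])
  finally show ?case by simp
qed simp

context
  fixes A :: "'a::banach \<Rightarrow> 'a"
  assumes A: "bounded_linear A"
begin

lemma summable_op_exp: "summable (\<lambda>k. Blinfun (A ^^ k) /\<^sub>R fact k)"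
proof (rule summable_comparison_test)
  show "\<exists>N. \<forall>k\<ge>N. norm (Blinfun (A ^^ k) /\<^sub>R fact k) \<le> onorm A ^ k /\<^sub>R fact k"
  proof (intro exI allI impI)
    fix k
    have "norm (Blinfun (A ^^ k)) \<le> onorm A ^ k"
      using onorm_pos_le[OF A] norm_funpow_le[OF A, of k]
      by (intro norm_blinfun_bound)
        (simp_all add: bounded_linear_Blinfun_apply bounded_linear_funpow[OF A])
    thus "norm (Blinfun (A ^^ k) /\<^sub>R fact k) \<le> onorm A ^ k /\<^sub>R fact k"
      by (simp add: mult_left_mono)
  qed
qed (rule summable_exp_generic)

text \<open>Evaluation at \<open>f\<close> is continuous for the operator norm, so the series also
  converges pointwise; later computations with exponentials start from this form.\<close>

lemma op_exp_sums: "(\<lambda>k. (A ^^ k) f /\<^sub>R fact k) sums op_exp A f"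
proof -
  have "(\<lambda>k. blinfun_apply (Blinfun (A ^^ k) /\<^sub>R fact k) f) sums op_exp A f"
    unfolding op_exp_def
    by (rule bounded_linear.sums[OF blinfun.bounded_linear_left summable_sums[OF summable_op_exp]])
  thus ?thesis
    by (simp add: blinfun.scaleR_left bounded_linear_Blinfun_apply bounded_linear_funpow[OF A])
qed

lemma bounded_linear_op_exp: "bounded_linear (op_exp A)"
  unfolding op_exp_def by (rule blinfun.bounded_linear_right)

lemma funpow_scaleR: "((\<lambda>g. t *\<^sub>R A g) ^^ k) f = t ^ k *\<^sub>R (A ^^ k) f"
  by (induction k) (simp_all add: linear_simps[OF A])

end

lemma op_exp_scaleR_sums:
  fixes A :: "'a::banach \<Rightarrow> 'a" and t :: real
  assumes A: "bounded_linear A"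
  shows "(\<lambda>k. t ^ k *\<^sub>R (A ^^ k) f /\<^sub>R fact k) sums op_exp (\<lambda>g. t *\<^sub>R A g) f"
  (is "?s sums _")
proof -
  have "bounded_linear (\<lambda>g. t *\<^sub>R A g)"
    using bounded_linear_compose[OF bounded_linear_scaleR_right A] .
  from op_exp_sums[OF this] show ?thesis by (simp add: funpow_scaleR[OF A])
qed

context
  fixes A :: "'a::banach \<Rightarrow> 'a"
  assumes A: "bounded_linear A"
begin

text \<open>Term-by-term differentiation: shifting the index turns the differentiated series into
  \<open>A\<close> applied to the original one, and on a bounded interval an exponential series in
  \<open>R * onorm A\<close> dominates it.\<close>

lemma op_exp_scaleR_vector_derivative:
  "((\<lambda>t. op_exp (\<lambda>g. t *\<^sub>R A g) f) has_vector_derivative A (op_exp (\<lambda>g. t *\<^sub>R A g) f)) (at t)"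
proof -
  \<comment> \<open>Any radius exceeding \<open>\<bar>t\<bar>\<close> would do: it puts
    \<open>t\<close> inside the open interval \<open>S\<close>, where the derivative within
    \<open>S\<close> is the full derivative.\<close>
  define R where "R = \<bar>t\<bar> + 1"
  define S where "S = {-R<..<R}"
  define v where "v = (\<lambda>k. (A ^^ k) f /\<^sub>R fact k)"
  define d where "d = (\<lambda>k x. (real k * x ^ (k - 1)) *\<^sub>R v k)"
  define e where "e = (\<lambda>x. op_exp (\<lambda>g. x *\<^sub>R A g) f)"
  have R: "R > 0" and tS: "t \<in> S" by (auto simp: R_def S_def abs_real_def)
  have e_sums: "(\<lambda>k. x ^ k *\<^sub>R v k) sums e x" for x
    using op_exp_scaleR_sums[OF A, of x f] by (simp add: e_def v_def mult.commute)
  have d_Suc: "d (Suc k) x = A (x ^ k *\<^sub>R v k)" for k x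
  proof -
    have "inverse (fact k :: real) = real (Suc k) * inverse (fact (Suc k))"
      unfolding fact_Suc by (simp del: of_nat_Suc)
    thus ?thesis
      by (simp add: d_def v_def linear_simps[OF A] mult_ac del: of_nat_Suc fact_Suc)
  qed
  have d_sums: "(\<lambda>k. d k x) sums A (e x)" for x
  proof -
    have "(\<lambda>k. d (Suc k) x) sums A (e x)"
      unfolding d_Suc by (rule bounded_linear.sums[OF A e_sums])
    thus ?thesis by (subst (asm) sums_Suc_iff) (simp add: d_def)
  qed
  have bound: "norm (d (Suc k) x) \<le> onorm A * norm f * ((R * onorm A) ^ k /\<^sub>R fact k)" if "x \<in> S" for k x
  proof -
    have "norm (v k) \<le> onorm A ^ k * norm f / fact k"
      using norm_funpow_le[OF A, of k f] by (simp add: v_def field_simps)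
    moreover have "\<bar>x\<bar> ^ k \<le> R ^ k" using that by (intro power_mono) (auto simp: S_def)
    ultimately have "\<bar>x\<bar> ^ k * norm (v k) \<le> R ^ k * (onorm A ^ k * norm f / fact k)"
      using R by (intro mult_mono) auto
    hence "onorm A * norm (x ^ k *\<^sub>R v k) \<le> onorm A * (R ^ k * (onorm A ^ k * norm f / fact k))"
      by (intro mult_left_mono onorm_pos_le[OF A]) (simp add: power_abs)
    with onorm[OF A, of "x ^ k *\<^sub>R v k"]
    have "norm (d (Suc k) x) \<le> onorm A * (R ^ k * (onorm A ^ k * norm f / fact k))"
      unfolding d_Suc by linarith
    thus ?thesis by (simp add: power_mult_distrib field_simps)
  qed
  have "uniform_limit S (\<lambda>n x. \<Sum>k<n. d k x) (\<lambda>x. \<Sum>k. d k x) sequentially"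
  proof (rule Weierstrass_m_test)
    let ?M = "\<lambda>k. case k of 0 \<Rightarrow> 0 | Suc k \<Rightarrow> onorm A * norm f * ((R * onorm A) ^ k /\<^sub>R fact k)"
    show "norm (d k x) \<le> ?M k" if "x \<in> S" for k x
      using bound[OF that] by (cases k) (simp_all add: d_def)
    have "summable (\<lambda>k. ?M (Suc k))"
      unfolding nat.case by (intro summable_mult summable_exp_generic)
    thus "summable ?M" by (subst (asm) summable_Suc_iff)
  qed
  hence unif: "uniform_limit S (\<lambda>n x. \<Sum>k<n. d k x) (\<lambda>x. A (e x)) sequentially"
    using d_sums by (simp add: sums_iff)
  have "\<exists>g. \<forall>x\<in>S. (\<lambda>k. x ^ k *\<^sub>R v k) sums g x \<and>
      (g has_derivative (\<lambda>h. h *\<^sub>R A (e x))) (at x within S)"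
  proof (rule has_derivative_series[where f' = "\<lambda>k x h. h *\<^sub>R d k x"])
    show "convex S" by (simp add: S_def)
    show "((\<lambda>x. x ^ k *\<^sub>R v k) has_derivative (\<lambda>h. h *\<^sub>R d k x)) (at x within S)" for k x
      unfolding d_def by (auto intro!: derivative_eq_intros simp: mult_ac)
    show "\<forall>\<^sub>F n in sequentially. \<forall>x\<in>S. \<forall>h. norm ((\<Sum>k<n. h *\<^sub>R d k x) - h *\<^sub>R A (e x)) \<le> \<epsilon> * norm h"
      if "\<epsilon> > 0" for \<epsilon>
      using uniform_limitD[OF unif that]
    proof eventually_elim
      case (elim n)
      show ?case
      proof (intro ballI allI)
        fix x h :: real assume "x \<in> S"
        with elim have "norm ((\<Sum>k<n. d k x) - A (e x)) \<le> \<epsilon>" by (auto simp: dist_norm)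
        from mult_right_mono[OF this, of "norm h"]
        show "norm ((\<Sum>k<n. h *\<^sub>R d k x) - h *\<^sub>R A (e x)) \<le> \<epsilon> * norm h"
          by (simp add: mult.commute flip: scaleR_sum_right scaleR_diff_right)
      qed
    qed
  qed (use tS e_sums in auto)
  then obtain g where g: "\<And>x. x \<in> S \<Longrightarrow> (\<lambda>k. x ^ k *\<^sub>R v k) sums g x"
    "\<And>x. x \<in> S \<Longrightarrow> (g has_derivative (\<lambda>h. h *\<^sub>R A (e x))) (at x within S)" by blast
  have "(g has_derivative (\<lambda>h. h *\<^sub>R A (e t))) (at t)"
    using g(2)[OF tS] at_within_open[of t S] tS by (simp add: S_def)
  moreover have "g x = e x" if "x \<in> S" for x using sums_unique2[OF g(1)[OF that] e_sums] .
  ultimately have "(e has_derivative (\<lambda>h. h *\<^sub>R A (e t))) (at t)"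
    using tS by (intro has_derivative_transform_within_open[of g _ t UNIV S e]) (auto simp: S_def)
  thus ?thesis by (simp add: has_vector_derivative_def e_def)
qed

end

section \<open>Unitary groups of bounded symmetric operators\<close>

lemma op_exp_bounded_clinear:
  fixes A :: "'a::complex_hilbert \<Rightarrow> 'a"
  assumes A: "bounded_clinear A"
  shows "bounded_clinear (op_exp A)"
proof -
  note A' = bounded_clinear_bounded_linear[OF A]
  have "op_exp A (c *\<^sub>C f) = c *\<^sub>C op_exp A f" for c f
  proof -
    have "(A ^^ k) (c *\<^sub>C f) = c *\<^sub>C (A ^^ k) f" for k
      by (induction k) (simp_all add: bounded_clinear_scaleC[OF A])
    hence "(\<lambda>k. c *\<^sub>C ((A ^^ k) f /\<^sub>R fact k)) sums op_exp A (c *\<^sub>C f)"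
      using op_exp_sums[OF A', of "c *\<^sub>C f"] by (simp add: scaleC_scaleR)
    moreover have "(\<lambda>k. c *\<^sub>C ((A ^^ k) f /\<^sub>R fact k)) sums (c *\<^sub>C op_exp A f)"
      by (rule bounded_linear.sums[OF bounded_linear_scaleC_right op_exp_sums[OF A']])
    ultimately show ?thesis by (rule sums_unique2)
  qed
  thus ?thesis using bounded_linear_op_exp[OF A'] by (simp add: bounded_clinear_def)
qed

lemma bounded_clinear_scaleC_comp:
  assumes "bounded_clinear A"
  shows "bounded_clinear (\<lambda>g. c *\<^sub>C A g)"
  using assms bounded_linear_compose[OF bounded_linear_scaleC_right, of A c]
  by (simp add: bounded_clinear_def scaleC_scaleC mult.commute)

lemma norm_constant_if_skew:
  assumes "\<And>t. (w has_vector_derivative w' t) (at t)" "\<And>t. Re (cinner (w t) (w' t)) = 0"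
  shows "norm (w t) = norm (w 0)"
proof -
  have "((\<lambda>t. cinner (w t) (w t)) has_vector_derivative 0) (at t)" for t
  proof -
    have "cinner (w t) (w' t) + cinner (w' t) (w t) = 0"
      using assms(2)[of t] by (subst (2) cinner_commute) (simp add: complex_eq_iff)
    thus ?thesis using has_vector_derivative_cinner[OF assms(1) assms(1), of t] by simp
  qed
  from norm_diff_le_vector_derivative_bound[OF this, of "\<bar>t\<bar>" 0 t]
  have "cinner (w t) (w t) = cinner (w 0) (w 0)" by simp
  thus ?thesis by (simp add: cinner_self flip: of_real_power)
qed

definition unitary_exp :: "('a::complex_hilbert \<Rightarrow> 'a) \<Rightarrow> real \<Rightarrow> 'a \<Rightarrow> 'a" where
  "unitary_exp B t = op_exp (\<lambda>g. (\<i> * of_real t) *\<^sub>C B g)"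

text \<open>Isometry and the group law come from the differential equation rather than from
  multiplying series: \<open>A = \<i> B\<close> is skew, so the pairing of two solutions is constant
  in time, and the difference of two solutions with equal initial values keeps norm 0.\<close>

lemma unitary_exp_ugroup:
  fixes B :: "'a::complex_hilbert \<Rightarrow> 'a"
  assumes B: "bounded_clinear B" and sym: "\<And>x y. cinner y (B x) = cinner (B y) x"
  shows "ugroup UNIV B (unitary_exp B)"
proof -
  define A where "A = (\<lambda>g. \<i> *\<^sub>C B g)"
  note bA = bounded_clinear_bounded_linear[OF bounded_clinear_scaleC_comp[OF B, of \<i>, folded A_def]]
  have unitary_exp_A: "unitary_exp B t = op_exp (\<lambda>g. t *\<^sub>R A g)" for t
    by (simp add: unitary_exp_def A_def scaleC_scaleC mult.commute flip: scaleC_of_real)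
  have deriv: "((\<lambda>t. unitary_exp B t f) has_vector_derivative A (unitary_exp B t f)) (at t)" for t f
    unfolding unitary_exp_A by (rule op_exp_scaleR_vector_derivative[OF bA])
  have lin: "bounded_clinear (unitary_exp B t)" for t
    unfolding unitary_exp_def by (intro op_exp_bounded_clinear bounded_clinear_scaleC_comp B)
  have skew: "cinner x (A y) = - cinner (A x) y" for x y
    by (simp add: A_def cinner_simps sym)
  have zero: "unitary_exp B 0 f = f" for f
  proof -
    \<comment> \<open>Only the term \<open>k = 0\<close> survives, with
      \<open>0 ^ 0 = 1\<close>.\<close>
    have "(\<lambda>k. 0 ^ k *\<^sub>R (A ^^ k) f /\<^sub>R fact k) = (\<lambda>k. if k = 0 then f else 0)" by auto
    with op_exp_scaleR_sums[OF bA, of 0 f] have "(\<lambda>k. if k = 0 then f else 0) sums unitary_exp B 0 f"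
      by (simp only: unitary_exp_A)
    thus ?thesis by (rule sums_unique2[OF _ sums_single[of 0 "\<lambda>_. f"]])
  qed
  have iso: "cinner (unitary_exp B t f) (unitary_exp B t g) = cinner f g" for t f g
  proof -
    have "((\<lambda>t. cinner (unitary_exp B t f) (unitary_exp B t g)) has_vector_derivative 0) (at t)" for t
      using has_vector_derivative_cinner[OF deriv deriv, of f g t] by (simp add: skew)
    from norm_diff_le_vector_derivative_bound[OF this, of "\<bar>t\<bar>" 0 t]
    show ?thesis by (simp add: zero)
  qed
  have add: "unitary_exp B (t + s) f = unitary_exp B t (unitary_exp B s f)" for s t f
  proof -
    define w where "w = (\<lambda>t. unitary_exp B (t + s) f - unitary_exp B t (unitary_exp B s f))"
    have "((\<lambda>t. unitary_exp B (t + s) f) has_vector_derivative A (unitary_exp B (t + s) f)) (at t)" for t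
      using deriv[of f "t + s"]
      unfolding has_vector_derivative_at_iff_quotient by (simp add: add.commute add.left_commute)
    hence "(w has_vector_derivative A (w t)) (at t)" for t
      unfolding w_def linear_simps[OF bA] by (intro has_vector_derivative_diff deriv)
    moreover have "Re (cinner (w t) (A (w t))) = 0" for t
      using skew[of "w t" "w t"] by (subst (asm) (2) cinner_commute) (simp add: complex_eq_iff)
    ultimately have "norm (w t) = norm (w 0)" by (rule norm_constant_if_skew)
    thus ?thesis by (simp add: w_def zero)
  qed
  have "sc_unitary_group (unitary_exp B)"
    unfolding sc_unitary_group_def unitary_def
  proof (intro conjI allI)
    show "surj (unitary_exp B t)" for t
      by (rule surjI[of _ "unitary_exp B (-t)"]) (simp add: zero flip: add)
    show "continuous_on UNIV (\<lambda>t. unitary_exp B t f)" for f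
      using has_vector_derivative_continuous[OF deriv] by (simp add: continuous_at_imp_continuous_on)
  qed (auto simp: lin iso add zero)
  moreover have "((\<lambda>h. (unitary_exp B h f - f) /\<^sub>R h) \<longlongrightarrow> \<i> *\<^sub>C B f) (at 0)" for f
    using deriv[of f 0] unfolding has_vector_derivative_at_iff_quotient by (simp add: zero A_def)
  ultimately show ?thesis by (intro selfadj.ugroupI selfadj_bounded B sym)
qed

lemma unitary_exp_commute:
  fixes B :: "'a::complex_hilbert \<Rightarrow> 'a"
  assumes B: "bounded_clinear B" and C: "bounded_clinear C" and BC: "\<And>x. B (C x) = C (B x)"
  shows "unitary_exp B t (C f) = C (unitary_exp B t f)"
proof -
  let ?A = "\<lambda>g. (\<i> * of_real t) *\<^sub>C B g"
  note bA = bounded_clinear_bounded_linear[OF bounded_clinear_scaleC_comp[OF B]]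
  note bC = bounded_clinear_bounded_linear[OF C]
  have "(?A ^^ k) (C f) = C ((?A ^^ k) f)" for k
    by (induction k) (simp_all add: BC bounded_clinear_scaleC[OF C])
  hence "(\<lambda>k. C ((?A ^^ k) f /\<^sub>R fact k)) sums op_exp ?A (C f)"
    using op_exp_sums[OF bA, of "\<i> * of_real t" "C f"] by (simp add: linear_simps[OF bC])
  thus ?thesis
    unfolding unitary_exp_def by (rule sums_unique2) (rule bounded_linear.sums[OF bC op_exp_sums[OF bA]])
qed

section \<open>Stone's theorem\<close>

lemma uniform_limit_dense:
  fixes L :: "'i \<Rightarrow> 't \<Rightarrow> 'a::metric_space \<Rightarrow> 'b::metric_space"
  assumes D: "closure D = UNIV"
    and L: "\<And>x t f g. dist (L x t f) (L x t g) \<le> K * dist f g"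
    and M: "\<And>t f g. dist (M t f) (M t g) \<le> K * dist f g"
    and conv: "\<And>f. f \<in> D \<Longrightarrow> uniform_limit I (\<lambda>x t. L x t f) (\<lambda>t. M t f) F"
  shows "uniform_limit I (\<lambda>x t. L x t f) (\<lambda>t. M t f) F"
proof (rule uniform_limitI)
  fix e :: real assume e: "e > 0"
  \<comment> \<open>The summand 1 keeps \<open>c\<close> positive when \<open>K = 0\<close>; the
    choice of \<open>d\<close> then makes \<open>K * d\<close> at most a third of
    \<open>e\<close>.\<close>
  define c where "c = \<bar>K\<bar> + 1"
  define d where "d = e / (3 * c)"
  have c: "c > 0" unfolding c_def by linarith
  have d: "d > 0" using e c by (simp add: d_def)
  have "K * d \<le> \<bar>K\<bar> * d" using d by (intro mult_right_mono) auto
  also have "\<dots> \<le> c * d" using d by (intro mult_right_mono) (auto simp: c_def)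
  also have "\<dots> = e / 3" using c by (simp add: d_def)
  finally have Kd: "K * d \<le> e / 3" .
  obtain g where g: "g \<in> D" "dist g f < d"
    using D d closure_approachable[of f D] by auto
  have "K * dist f g \<le> e / 3"
  proof (cases "K \<ge> 0")
    case True
    hence "K * dist f g \<le> K * d" using g(2) by (intro mult_left_mono) (auto simp: dist_commute)
    with Kd show ?thesis by linarith
  next
    case False
    hence "K * dist f g \<le> 0" by (simp add: mult_nonpos_nonneg)
    with e show ?thesis by linarith
  qed
  hence near: "dist (L x t f) (L x t g) \<le> e / 3" "dist (M t f) (M t g) \<le> e / 3" for x t
    using L[of x t f g] M[of t f g] by linarith+
  have "e / 3 > 0" using e by simp
  from uniform_limitD[OF conv[OF g(1)] this]
  show "\<forall>\<^sub>F x in F. \<forall>t\<in>I. dist (L x t f) (M t f) < e"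
  proof eventually_elim
    case (elim x)
    show ?case
    proof
      fix t assume "t \<in> I"
      hence "dist (L x t g) (M t g) < e / 3" using elim by blast
      thus "dist (L x t f) (M t f) < e"
        using near(1)[of x t] near(2)[of t] dist_triangle[of "L x t f" "M t f" "L x t g"]
          dist_triangle[of "L x t g" "M t f" "M t g"] dist_commute[of "M t g" "M t f"] by linarith
    qed
  qed
qed

lemma tendsto_dense:
  fixes L :: "'i \<Rightarrow> 'a::metric_space \<Rightarrow> 'b::metric_space"
  assumes "closure D = UNIV" "\<And>x f g. dist (L x f) (L x g) \<le> K * dist f g"
    "\<And>f g. dist (M f) (M g) \<le> K * dist f g" "\<And>f. f \<in> D \<Longrightarrow> ((\<lambda>x. L x f) \<longlongrightarrow> M f) F"
  shows "((\<lambda>x. L x f) \<longlongrightarrow> M f) F"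
  using uniform_limit_dense[OF assms(1), of "\<lambda>x t f. L x f" K "\<lambda>t f. M f" "{()}" F f] assms(2-4)
  by (simp add: tendsto_uniform_limitI uniform_limit_singleton)

section \<open>Yosida approximations and the limit of their groups\<close>

context selfadj
begin

lemma Res_diff_arg: "r \<noteq> 0 \<Longrightarrow> Res r (f - g) = Res r f - Res r g"
  using bounded_clinear_bounded_linear[OF bounded_clinear_Res] by (simp add: linear_simps)

text \<open>Equal to \<open>r\<^sup>2 H (H\<^sup>2 + r\<^sup>2)\<^sup>-\<^sup>1\<close>; symmetrizing the usual Yosida approximation makes it self-adjoint.\<close>

definition yosida :: "real \<Rightarrow> 'a \<Rightarrow> 'a" where
  "yosida r g = of_real (r\<^sup>2 / 2) *\<^sub>C (Res r g + Res (- r) g)"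

lemma bounded_clinear_Yos: "r \<noteq> 0 \<Longrightarrow> bounded_clinear (yosida r)"
proof -
  assume r: "r \<noteq> 0"
  hence "bounded_clinear (\<lambda>g. Res r g + Res (- r) g)"
    using bounded_clinear_Res[of r] bounded_clinear_Res[of "-r"]
    by (simp add: bounded_clinear_def bounded_linear_add scaleC_add_right)
  thus ?thesis
    unfolding yosida_def[abs_def] by (rule bounded_clinear_scaleC_comp)
qed

lemma cinner_Yos: "r \<noteq> 0 \<Longrightarrow> cinner y (yosida r x) = cinner (yosida r y) x"
  using cinner_Res[of r y x] cinner_Res[of "-r" y x] by (simp add: yosida_def cinner_simps)

lemma yosida_commute: "r \<noteq> 0 \<Longrightarrow> s \<noteq> 0 \<Longrightarrow> yosida r (yosida s g) = yosida s (yosida r g)"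
  using Res_commute[of r s g] Res_commute[of r "-s" g] Res_commute[of "-r" s g] Res_commute[of "-r" "-s" g]
  by (simp add: yosida_def Res_add Res_scale scaleC_add_right scaleC_scaleC mult.commute add_ac)

text \<open>One factor \<open>r\<close> is used up in moving \<open>H\<close> under each resolvent,
  and the multiples of \<open>f\<close> that arise cancel between the two signs. What remains is an
  average to which \<open>scaled_Res_tendsto\<close> applies.\<close>

lemma yosida_eq:
  assumes "f \<in> D" "r \<noteq> 0"
  shows "yosida r f = (- 1 / 2) *\<^sub>C ((\<i> * of_real r) *\<^sub>C Res r (H f) + (\<i> * of_real (- r)) *\<^sub>C Res (- r) (H f))"
proof -
  have R: "Res s (H f) = f + (\<i> * of_real s) *\<^sub>C Res s f" if "s \<noteq> 0" for s
    using Res_shift[OF that assms(1)] that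
    by (simp add: Res_diff_arg Res_scale diff_eq_eq)
  show ?thesis
    unfolding R[OF assms(2)] R[of "-r", simplified, OF assms(2)] yosida_def
    by (simp add: scaleC_simps power2_eq_square algebra_simps)
qed

text \<open>On \<open>D\<close> the scaled resolvent at \<open>r\<close> takes \<open>f\<close> to
  \<open>Res r (H f) - f\<close>, where the first term has norm at most
  \<open>norm (H f) / \<bar>r\<bar>\<close>; contractivity extends the limit to all vectors. The
  growth condition is on \<open>\<bar>\<rho> n\<bar>\<close> so that both signs are covered.\<close>

lemma scaled_Res_tendsto:
  fixes \<rho> :: "nat \<Rightarrow> real"
  assumes nz: "\<And>n. \<rho> n \<noteq> 0" and lim: "filterlim (\<lambda>n. \<bar>\<rho> n\<bar>) at_top sequentially"
  shows "(\<lambda>n. (\<i> * of_real (\<rho> n)) *\<^sub>C Res (\<rho> n) g) \<longlonglongrightarrow> - g"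
proof (rule tendsto_dense[where K = 1 and L = "\<lambda>n g. (\<i> * of_real (\<rho> n)) *\<^sub>C Res (\<rho> n) g"
      and M = "\<lambda>g. - g", OF dense])
  show "dist ((\<i> * of_real (\<rho> n)) *\<^sub>C Res (\<rho> n) f) ((\<i> * of_real (\<rho> n)) *\<^sub>C Res (\<rho> n) g) \<le> 1 * dist f g"
    for n f g
    using norm_Res[OF nz, of n "f - g"]
    by (simp add: dist_norm norm_scaleC norm_mult nz Res_diff_arg flip: scaleC_diff_right)
  show "dist (- f) (- g) \<le> 1 * dist f g" for f g :: 'a
    by (simp add: dist_norm norm_minus_commute)
  fix f assume f: "f \<in> D"
  have eq: "(\<i> * of_real (\<rho> n)) *\<^sub>C Res (\<rho> n) f = Res (\<rho> n) (H f) - f" for n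
    using Res_shift[OF nz f, of n] by (simp add: Res_diff_arg Res_scale nz algebra_simps)
  have "(\<lambda>n. Res (\<rho> n) (H f)) \<longlonglongrightarrow> 0"
  proof (rule Lim_null_comparison)
    show "\<forall>\<^sub>F n in sequentially. norm (Res (\<rho> n) (H f)) \<le> norm (H f) / \<bar>\<rho> n\<bar>"
      using norm_Res[OF nz, of _ "H f"] nz by (auto simp: field_simps)
    show "(\<lambda>n. norm (H f) / \<bar>\<rho> n\<bar>) \<longlonglongrightarrow> 0"
      by (rule tendsto_divide_0[OF tendsto_const filterlim_at_top_imp_at_infinity[OF lim]])
  qed
  from tendsto_diff[OF this tendsto_const, of f]
  show "(\<lambda>n. (\<i> * of_real (\<rho> n)) *\<^sub>C Res (\<rho> n) f) \<longlonglongrightarrow> - f"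
    unfolding eq by simp
qed

lemma yosida_tendsto:
  assumes f: "f \<in> D"
  shows "(\<lambda>n. yosida (real (Suc n)) f) \<longlonglongrightarrow> H f"
proof -
  have lim: "filterlim (\<lambda>n. \<bar>real (Suc n)\<bar>) at_top sequentially"
    using filterlim_compose[OF filterlim_real_sequentially filterlim_Suc] by (simp only: abs_of_nat)
  have "(\<lambda>n. yosida (real (Suc n)) f) \<longlonglongrightarrow> (- 1 / 2) *\<^sub>C (- H f + - H f)"
    unfolding yosida_eq[OF f of_nat_neq_0]
    by (intro tendsto_intros scaled_Res_tendsto) (use lim in \<open>auto simp: add.commute\<close>)
  also have "(- 1 / 2) *\<^sub>C (- H f + - H f) = H f"
    by (simp add: scaleC_simps flip: scaleC_add_left)
  finally show ?thesis .
qed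

text \<open>The parameter is \<open>Suc n\<close> because the resolvents are meaningful only away
  from 0.\<close>

definition yosida_group :: "nat \<Rightarrow> real \<Rightarrow> 'a \<Rightarrow> 'a" where
  "yosida_group n = unitary_exp (yosida (real (Suc n)))"

lemma yosida_group_ugroup: "ugroup UNIV (yosida (real (Suc n))) (yosida_group n)"
  unfolding yosida_group_def by (intro unitary_exp_ugroup bounded_clinear_Yos cinner_Yos) auto

text \<open>Since the approximations commute, the Duhamel error along an orbit of the
  \<open>n\<close>th group is that group applied to a fixed vector, up to the factor \<i>, so its
  norm does not depend on time.\<close>

lemma yosida_group_diff_le:
  "norm (yosida_group n t f - yosida_group m t f) \<le> norm (yosida (real (Suc n)) f - yosida (real (Suc m)) f) * \<bar>t\<bar>"
proof -
  let ?Y = "\<lambda>n. yosida (real (Suc n))"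
  interpret m: ugroup UNIV "?Y m" "yosida_group m" by (rule yosida_group_ugroup)
  interpret n: ugroup UNIV "?Y n" "yosida_group n" by (rule yosida_group_ugroup)
  have comm: "?Y m (yosida_group n \<tau> f) = yosida_group n \<tau> (?Y m f)" for \<tau>
    unfolding yosida_group_def
    by (intro unitary_exp_commute[symmetric] bounded_clinear_Yos yosida_commute) auto
  have "norm (yosida_group n t f - yosida_group m t (yosida_group n 0 f)) \<le> norm (?Y n f - ?Y m f) * \<bar>t\<bar>"
  proof (rule m.duhamel_bound[where r = "\<lambda>\<tau>. \<i> *\<^sub>C yosida_group n \<tau> (?Y n f - ?Y m f)" and T = "\<bar>t\<bar>"])
    show "((\<lambda>t. yosida_group n t f) has_vector_derivative
        \<i> *\<^sub>C ?Y m (yosida_group n \<tau> f) + \<i> *\<^sub>C yosida_group n \<tau> (?Y n f - ?Y m f)) (at \<tau>)" for \<tau>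
      using n.U_vector_derivative[of f \<tau>]
      by (simp add: comm n.U_diff n.H_U scaleC_diff_right del: of_nat_Suc)
  qed (simp_all add: norm_scaleC del: of_nat_Suc)
  thus ?thesis by simp
qed

lemma yosida_group_uniformly_Cauchy: "uniformly_Cauchy_on {-T..T} (\<lambda>n t. yosida_group n t f)"
proof (rule uniformly_Cauchy_onI)
  fix e :: real assume e: "e > 0"
  \<comment> \<open>Each replacement of \<open>f\<close> by \<open>g\<close> costs
    \<open>e / 4\<close>; the other \<open>e / 2\<close> is left for the Yosida approximations,
    which converge at \<open>g\<close>.\<close>
  obtain g where g: "g \<in> D" "dist g f < e / 4"
    using dense e closure_approachable[of f D] by (auto dest: spec[of _ "e / 4"])
  define c where "c = \<bar>T\<bar> + 1"
  define d where "d = e / (2 * c)"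
  have c: "c > 0" unfolding c_def by linarith
  hence d: "d > 0" and dT: "d * c = e / 2" using e by (auto simp: d_def)
  from metric_CauchyD[OF LIMSEQ_imp_Cauchy[OF yosida_tendsto[OF g(1)]] d]
  obtain N where N: "\<And>m n. m \<ge> N \<Longrightarrow> n \<ge> N \<Longrightarrow> dist (yosida (real (Suc n)) g) (yosida (real (Suc m)) g) < d"
    by blast
  show "\<exists>M. \<forall>t\<in>{-T..T}. \<forall>m\<ge>M. \<forall>n\<ge>M. dist (yosida_group m t f) (yosida_group n t f) < e"
  proof (intro exI[of _ N] ballI allI impI)
    fix t m n assume t: "t \<in> {-T..T}" and mn: "m \<ge> N" "n \<ge> N"
    interpret m: ugroup UNIV "yosida (real (Suc m))" "yosida_group m" by (rule yosida_group_ugroup)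
    interpret n: ugroup UNIV "yosida (real (Suc n))" "yosida_group n" by (rule yosida_group_ugroup)
    have "dist (yosida_group m t g) (yosida_group n t g) \<le> d * c"
      unfolding dist_norm
      by (rule order_trans[OF yosida_group_diff_le], rule mult_mono)
        (use N[OF mn(2,1)] d t in \<open>auto simp: dist_norm c_def\<close>)
    moreover have "dist (yosida_group m t f) (yosida_group m t g) < e / 4" "dist (yosida_group n t g) (yosida_group n t f) < e / 4"
      using g(2) by (simp_all add: dist_norm norm_minus_commute)
    ultimately show "dist (yosida_group m t f) (yosida_group n t f) < e"
      using dist_triangle[of "yosida_group m t f" "yosida_group n t f" "yosida_group m t g"]
        dist_triangle[of "yosida_group m t g" "yosida_group n t f" "yosida_group n t g"] dT by linarith
  qed
qed

theorem stone: "\<exists>U. ugroup D H U"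
proof -
  define U where "U = (\<lambda>t f. lim (\<lambda>n. yosida_group n t f))"
  have unif: "uniform_limit {-T..T} (\<lambda>n t. yosida_group n t f) (\<lambda>t. U t f) sequentially" for T f
    unfolding U_def uniformly_convergent_uniform_limit_iff[symmetric]
    by (rule Cauchy_uniformly_convergent[OF yosida_group_uniformly_Cauchy])
  have lim: "(\<lambda>n. yosida_group n t f) \<longlonglongrightarrow> U t f" for t f
    by (rule tendsto_uniform_limitI[OF unif[where T = "\<bar>t\<bar>"]]) auto
  note Y_lin = ugroup.U_bounded_clinear[OF yosida_group_ugroup]
  note Y_blin = bounded_clinear_bounded_linear[OF Y_lin]
  have U_add: "U t (f + g) = U t f + U t g" for t f g
    using tendsto_add[OF lim lim, of t f t g] LIMSEQ_unique[OF lim] by (simp add: linear_simps[OF Y_blin])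
  have U_scale: "U t (c *\<^sub>C f) = c *\<^sub>C U t f" for t c f
    using tendsto_scaleC[OF tendsto_const lim, of c t f] LIMSEQ_unique[OF lim]
    by (simp add: bounded_clinear_scaleC[OF Y_lin])
  have U_cinner: "cinner (U t f) (U t g) = cinner f g" for t f g
    using tendsto_cinner[OF lim lim, of t f t g] by (simp add: ugroup.U_cinner[OF yosida_group_ugroup] LIMSEQ_const_iff)
  have U_0: "U 0 f = f" for f
    using lim[of 0 f] by (simp add: ugroup.U_0[OF yosida_group_ugroup] LIMSEQ_const_iff)
  \<comment> \<open>The groups are isometric, so a convergent argument may vary along with
    \<open>n\<close>; the group law of the limit needs this for the inner factor.\<close>
  have lim2: "(\<lambda>n. yosida_group n s (g n)) \<longlonglongrightarrow> U s l" if "g \<longlonglongrightarrow> l" for s g l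
  proof -
    have "(\<lambda>n. norm (g n - l)) \<longlonglongrightarrow> 0"
      using that by (simp add: LIM_zero tendsto_norm_zero)
    hence "(\<lambda>n. yosida_group n s (g n) - yosida_group n s l) \<longlonglongrightarrow> 0"
      by (subst tendsto_norm_zero_iff[symmetric]) (simp add: ugroup.norm_U_diff[OF yosida_group_ugroup])
    from tendsto_add[OF this lim[of s l]] show ?thesis by simp
  qed
  have U_plus: "U (s + t) f = U s (U t f)" for s t f
  proof -
    have "(\<lambda>n. yosida_group n s (yosida_group n t f)) \<longlonglongrightarrow> U (s + t) f"
      using lim[of "s + t" f] by (simp add: ugroup.U_add[OF yosida_group_ugroup])
    thus ?thesis by (rule LIMSEQ_unique[OF _ lim2[OF lim]])
  qed
  have "continuous_on UNIV (\<lambda>t. U t f)" for f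
  proof (rule continuous_at_imp_continuous_on, rule ballI)
    fix t :: real
    define T where "T = \<bar>t\<bar> + 1"
    have "continuous_on {-T..T} (\<lambda>t. U t f)"
    proof (rule uniform_limit_theorem[OF _ unif])
      show "\<forall>\<^sub>F n in sequentially. continuous_on {-T..T} (\<lambda>t. yosida_group n t f)"
        by (rule always_eventually) (blast intro: continuous_on_subset[OF ugroup.U_continuous[OF yosida_group_ugroup]])
    qed simp
    moreover have "t \<in> interior {-T..T}" by (auto simp: T_def abs_real_def)
    ultimately show "isCont (\<lambda>t. U t f) t" by (rule continuous_on_interior)
  qed
  moreover have "bounded_clinear (U t)" for t
  proof (rule bounded_clinearI[where K = 1, OF U_add U_scale])
    show "norm (U t f) \<le> norm f * 1" for f by (simp add: norm_eq_sqrt_cinner U_cinner)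
  qed
  moreover have "surj (U t)" for t
    by (rule surjI[of _ "U (-t)"]) (simp add: U_0 flip: U_plus)
  ultimately have group: "sc_unitary_group U"
    by (auto simp: sc_unitary_group_def unitary_def U_cinner U_0 U_plus)
  have "((\<lambda>h. (U h f - f) /\<^sub>R h) \<longlongrightarrow> \<i> *\<^sub>C H f) (at 0)" if f: "f \<in> D" for f
  proof -
    let ?S = "{-1<..<1::real}" and ?Y = "\<lambda>n. yosida (real (Suc n)) f"
    \<comment> \<open>The derivatives converge uniformly near 0: one half of \<open>e\<close> pays
      for replacing \<open>?Y n\<close> by \<open>H f\<close>, the other for replacing the
      approximating group by its limit.\<close>
    have "\<exists>g. \<forall>x\<in>?S. (\<lambda>n. yosida_group n x f) \<longlonglongrightarrow> g x \<and>
        (g has_derivative (\<lambda>h. h *\<^sub>R \<i> *\<^sub>C U x (H f))) (at x within ?S)"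
    proof (rule has_derivative_sequence[where f' = "\<lambda>n x h. h *\<^sub>R \<i> *\<^sub>C yosida_group n x (?Y n)"])
      show "((\<lambda>x. yosida_group n x f) has_derivative (\<lambda>h. h *\<^sub>R \<i> *\<^sub>C yosida_group n x (?Y n))) (at x within ?S)" for n x
        using ugroup.U_vector_derivative[OF yosida_group_ugroup, of f n x]
          ugroup.H_U[OF yosida_group_ugroup, of f n x]
        by (simp add: has_vector_derivative_def has_derivative_at_withinI)
      fix e :: real assume e: "e > 0"
      have "\<forall>\<^sub>F n in sequentially. \<forall>x\<in>{-1..1}. dist (yosida_group n x (H f)) (U x (H f)) < e / 2"
        using e by (intro uniform_limitD[OF unif]) auto
      moreover have "\<forall>\<^sub>F n in sequentially. dist (?Y n) (H f) < e / 2"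
        using e by (intro tendstoD[OF yosida_tendsto[OF f]]) auto
      ultimately show "\<forall>\<^sub>F n in sequentially. \<forall>x\<in>?S. \<forall>h.
          norm (h *\<^sub>R \<i> *\<^sub>C yosida_group n x (?Y n) - h *\<^sub>R \<i> *\<^sub>C U x (H f)) \<le> e * norm h"
      proof eventually_elim
        case (elim n)
        show ?case
        proof (intro ballI allI)
          fix x h :: real assume "x \<in> ?S"
          hence "dist (yosida_group n x (H f)) (U x (H f)) < e / 2" using elim(1) by auto
          moreover have "dist (yosida_group n x (?Y n)) (yosida_group n x (H f)) < e / 2"
            using elim(2) by (simp add: dist_norm ugroup.norm_U_diff[OF yosida_group_ugroup])
          ultimately have "dist (yosida_group n x (?Y n)) (U x (H f)) \<le> e"
            using dist_triangle[of "yosida_group n x (?Y n)" "U x (H f)" "yosida_group n x (H f)"] by linarith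
          from mult_right_mono[OF this, of "\<bar>h\<bar>"]
          show "norm (h *\<^sub>R \<i> *\<^sub>C yosida_group n x (?Y n) - h *\<^sub>R \<i> *\<^sub>C U x (H f)) \<le> e * norm h"
            by (simp add: dist_norm norm_scaleC mult.commute flip: scaleR_diff_right scaleC_diff_right)
        qed
      qed
    qed (auto intro: lim[of 0 f])
    then obtain g where g: "\<And>x. x \<in> ?S \<Longrightarrow> (\<lambda>n. yosida_group n x f) \<longlonglongrightarrow> g x"
      "\<And>x. x \<in> ?S \<Longrightarrow> (g has_derivative (\<lambda>h. h *\<^sub>R \<i> *\<^sub>C U x (H f))) (at x within ?S)" by blast
    have "(g has_derivative (\<lambda>h. h *\<^sub>R \<i> *\<^sub>C H f)) (at 0 within UNIV)"
      using g(2)[of 0] at_within_open[of 0 ?S] by (simp add: U_0)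
    hence "((\<lambda>x. U x f) has_derivative (\<lambda>h. h *\<^sub>R \<i> *\<^sub>C H f)) (at 0)"
    proof (rule has_derivative_transform_within_open)
      show "g x = U x f" if "x \<in> ?S" for x using LIMSEQ_unique[OF g(1)[OF that] lim] .
    qed auto
    hence "((\<lambda>x. U x f) has_vector_derivative \<i> *\<^sub>C H f) (at 0)"
      by (simp add: has_vector_derivative_def)
    thus ?thesis by (simp add: has_vector_derivative_at_iff_quotient U_0)
  qed
  with group have "ugroup D H U" by (rule ugroupI)
  thus ?thesis by blast
qed

end

section \<open>Strong resolvent convergence\<close>

text \<open>Nonexpansive maps are controlled on a compact set by their values on a finite net of
  mesh \<open>e / 3\<close>.\<close>

lemma uniform_limit_compact:
  fixes L :: "'i \<Rightarrow> 'a::metric_space \<Rightarrow> 'b::metric_space"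
  assumes K: "compact K"
    and L: "\<And>x f g. dist (L x f) (L x g) \<le> dist f g" and M: "\<And>f g. dist (M f) (M g) \<le> dist f g"
    and conv: "\<And>f. ((\<lambda>x. L x f) \<longlongrightarrow> M f) F"
  shows "uniform_limit K L M F"
proof (rule uniform_limitI)
  fix e :: real assume "e > 0"
  hence e3: "e / 3 > 0" by simp
  then obtain k where k: "finite k" "K \<subseteq> (\<Union>f\<in>k. ball f (e / 3))"
    using seq_compact_imp_totally_bounded[OF K[unfolded compact_eq_seq_compact_metric]] by blast
  have "\<forall>\<^sub>F x in F. \<forall>f\<in>k. dist (L x f) (M f) < e / 3"
    using k(1) tendstoD[OF conv e3] by (simp add: eventually_ball_finite)
  thus "\<forall>\<^sub>F x in F. \<forall>f\<in>K. dist (L x f) (M f) < e"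
  proof eventually_elim
    case (elim x)
    show ?case
    proof
      fix f assume "f \<in> K"
      then obtain g where g: "g \<in> k" "dist g f < e / 3" using k(2) by auto
      have "dist (L x g) (M g) < e / 3" using elim g(1) by blast
      thus "dist (L x f) (M f) < e"
        using g(2) L[of x f g] M[of g f] dist_triangle[of "L x f" "M f" "L x g"]
          dist_triangle[of "L x g" "M f" "M g"] dist_commute[of f g] by linarith
    qed
  qed
qed

lemma (in selfadj) dist_Res_le: "dist (Res 1 f) (Res 1 g) \<le> dist f g"
  using norm_Res[of 1 "f - g"] by (simp add: dist_norm Res_diff_arg)

lemma (in ugroup) Res_U:
  assumes "r \<noteq> 0"
  shows "Res r (U t f) = U t (Res r f)"
proof -
  have "H (U t (Res r f)) - (\<i> * of_real r) *\<^sub>C U t (Res r f) = U t f"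
    using assms by (simp add: H_U Res_in flip: U_scale U_diff) (simp add: Res_eq)
  thus ?thesis using Res_shift[OF assms U_D[OF Res_in[OF assms]], of t f] by simp
qed

text \<open>Both groups are compared through the resolvents \<open>R\<^sub>s\<close> of \<open>B s\<close> and \<open>R\<close> of \<open>H\<close>:
  \<open>R\<^sub>s (U t x)\<close> solves the evolution equation of \<open>B s\<close> up to the error \<open>\<i> (R\<^sub>s - R) (U t (H x - \<i> x))\<close>, which
  is uniformly small because orbits over bounded time intervals are compact.\<close>

lemma (in ugroup) unitary_exp_uniform_limit:
  fixes B :: "'i \<Rightarrow> 'a \<Rightarrow> 'a"
  assumes B: "\<And>s. bounded_clinear (B s)" and Bsym: "\<And>s x y. cinner y (B s x) = cinner (B s y) x"
    and CD: "C \<subseteq> D"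
    and core: "\<And>x. x \<in> D \<Longrightarrow> \<exists>c. (\<forall>n. c n \<in> C) \<and> c \<longlonglongrightarrow> x \<and> (\<lambda>n. H (c n)) \<longlonglongrightarrow> H x"
    and conv: "\<And>f. f \<in> C \<Longrightarrow> ((\<lambda>s. B s f) \<longlongrightarrow> H f) F"
  shows "uniform_limit {-T..T} (\<lambda>s t. unitary_exp (B s) t f) (\<lambda>t. U t f) F"
proof -
  define R where "R = Res 1"
  define Rs where "Rs = (\<lambda>s. selfadj.Res UNIV (B s) 1)"
  have sa: "selfadj UNIV (B s)" for s by (rule selfadj_bounded[OF B Bsym])
  have ug: "ugroup UNIV (B s) (unitary_exp (B s))" for s by (rule unitary_exp_ugroup[OF B Bsym])
  have Rs_lin: "bounded_clinear (Rs s)" for s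
    unfolding Rs_def by (rule selfadj.bounded_clinear_Res[OF sa]) simp
  note Rs_blin = bounded_clinear_bounded_linear[OF Rs_lin]
  have Rs_shift: "Rs s (B s x - \<i> *\<^sub>C x) = x" for s x
    using selfadj.Res_shift[OF sa, of 1 x s] by (simp add: Rs_def)
  have B_Rs: "B s (Rs s x) = x + \<i> *\<^sub>C Rs s x" for s x
    using selfadj.H_Res[OF sa, of 1 s x] by (simp add: Rs_def)
  have R_shift: "x \<in> D \<Longrightarrow> R (H x - \<i> *\<^sub>C x) = x" for x
    using Res_shift[of 1 x] by (simp add: R_def)
  have R_dist: "dist (R f) (R g) \<le> dist f g" for f g
    unfolding R_def by (rule dist_Res_le)
  have Rs_dist: "dist (Rs s f) (Rs s g) \<le> dist f g" for s f g
    unfolding Rs_def by (rule selfadj.dist_Res_le[OF sa])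
  have Rs_conv: "((\<lambda>s. Rs s g) \<longlongrightarrow> R g) F" for g
  proof (rule tendsto_dense[where K = 1 and M = R and D = "(\<lambda>c. H c - \<i> *\<^sub>C c) ` C"])
    \<comment> \<open>\<open>H - \<i>\<close> is onto, and approximating \<open>R g\<close> from the
      core \<open>C\<close> in the graph norm approximates \<open>g\<close> by images of
      \<open>C\<close>.\<close>
    show "closure ((\<lambda>c. H c - \<i> *\<^sub>C c) ` C) = UNIV"
    proof (intro equalityI subsetI UNIV_I)
      fix g
      have x: "R g \<in> D" "H (R g) - \<i> *\<^sub>C R g = g"
        using Res_in[of 1 g] Res_eq[of 1 g] by (simp_all add: R_def)
      obtain c where c: "\<And>n. c n \<in> C" "c \<longlonglongrightarrow> R g" "(\<lambda>n. H (c n)) \<longlonglongrightarrow> H (R g)"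
        using core[OF x(1)] by blast
      have "(\<lambda>n. H (c n) - \<i> *\<^sub>C c n) \<longlonglongrightarrow> g"
        using tendsto_diff[OF c(3) tendsto_scaleC[OF tendsto_const c(2), of \<i>]] x(2) by simp
      thus "g \<in> closure ((\<lambda>c. H c - \<i> *\<^sub>C c) ` C)"
        unfolding closure_sequential using c(1) by (intro exI[of _ "\<lambda>n. H (c n) - \<i> *\<^sub>C c n"]) auto
    qed
    fix g assume "g \<in> (\<lambda>c. H c - \<i> *\<^sub>C c) ` C"
    then obtain c where c: "c \<in> C" "g = H c - \<i> *\<^sub>C c" by blast
    \<comment> \<open>Here \<open>Rs s g - R g\<close> is \<open>Rs s\<close> applied to
      \<open>H c - B s c\<close>, and \<open>Rs s\<close> is a contraction.\<close>
    have le: "norm (Rs s g - R g) \<le> norm (B s c - H c)" for s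
    proof -
      have "R g = c" using c CD by (auto simp: R_shift)
      thus ?thesis
        using Rs_dist[of s g "B s c - \<i> *\<^sub>C c"] c(2) by (simp add: Rs_shift dist_norm norm_minus_commute)
    qed
    have lim: "((\<lambda>s. norm (B s c - H c)) \<longlongrightarrow> 0) F"
      using conv[OF c(1)] by (simp add: LIM_zero tendsto_norm_zero)
    have "((\<lambda>s. Rs s g - R g) \<longlongrightarrow> 0) F"
      by (rule Lim_null_comparison[OF always_eventually lim]) (simp add: le)
    thus "((\<lambda>s. Rs s g) \<longlongrightarrow> R g) F" by (rule LIM_zero_cancel)
  qed (simp_all add: R_dist Rs_dist)
  have orbit: "uniform_limit {-T..T} (\<lambda>s t. Rs s (U t h)) (\<lambda>t. R (U t h)) F" for h
  proof -
    have "compact ((\<lambda>t. U t h) ` {-T..T})"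
      by (intro compact_continuous_image continuous_on_subset[OF U_continuous]) auto
    from uniform_limit_compact[OF this Rs_dist R_dist Rs_conv]
    show ?thesis by (simp add: uniform_limit_iff)
  qed
  have duh: "norm (Rs s (U t x) - unitary_exp (B s) t (Rs s x)) \<le> M * \<bar>t\<bar>"
    if x: "x \<in> D" and t: "\<bar>t\<bar> \<le> T"
      and M: "\<forall>\<tau>\<in>{-T..T}. dist (Rs s (U \<tau> (H x - \<i> *\<^sub>C x))) (R (U \<tau> (H x - \<i> *\<^sub>C x))) \<le> M" for x t s M
  proof -
    let ?h = "H x - \<i> *\<^sub>C x"
    let ?r = "\<lambda>\<tau>. \<i> *\<^sub>C (Rs s (U \<tau> ?h) - R (U \<tau> ?h))"
    have Uh: "U \<tau> ?h = H (U \<tau> x) - \<i> *\<^sub>C U \<tau> x" for \<tau>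
      using x by (simp add: U_diff U_scale H_U)
    \<comment> \<open>\<open>R (U \<tau> ?h)\<close> is \<open>U \<tau> x\<close>, so adding the
      error cancels everything except the derivative of \<open>Rs s (U \<tau> x)\<close>.\<close>
    have r: "\<i> *\<^sub>C B s (Rs s (U \<tau> x)) + ?r \<tau> = Rs s (\<i> *\<^sub>C H (U \<tau> x))" for \<tau>
      unfolding Uh R_shift[OF U_D[OF x]]
      by (simp add: B_Rs linear_simps[OF Rs_blin] bounded_clinear_scaleC[OF Rs_lin] scaleC_add_right
          scaleC_diff_right)
    have "norm (Rs s (U t x) - unitary_exp (B s) t (Rs s (U 0 x))) \<le> M * \<bar>t\<bar>"
    proof (rule ugroup.duhamel_bound[OF ug, where r = ?r and T = T])
      show "((\<lambda>t. Rs s (U t x)) has_vector_derivative \<i> *\<^sub>C B s (Rs s (U \<tau> x)) + ?r \<tau>) (at \<tau>)" for \<tau>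
        unfolding r by (rule bounded_linear.has_vector_derivative[OF Rs_blin U_vector_derivative[OF x]])
      show "norm (?r \<tau>) \<le> M" if "\<bar>\<tau>\<bar> \<le> T" for \<tau>
        using M that by (auto simp: norm_scaleC dist_norm abs_le_iff)
    qed (use t in auto)
    thus ?thesis by simp
  qed
  \<comment> \<open>Vectors \<open>R x\<close> with \<open>x\<close> in \<open>D\<close> form the
    domain of the square of \<open>H\<close>. Membership of \<open>x\<close> in \<open>D\<close>
    makes its orbit differentiable; the errors are exchanging \<open>R x\<close> for
    \<open>Rs s x\<close> at the start, Duhamel's bound, and exchanging \<open>Rs s\<close> for
    \<open>R\<close> at the end.\<close>
  have "uniform_limit {-T..T} (\<lambda>s t. unitary_exp (B s) t f) (\<lambda>t. U t f) F" if f: "f \<in> R ` D" for f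
  proof (rule uniform_limitI)
    fix e :: real assume e: "e > 0"
    obtain x where x: "x \<in> D" "f = R x" using f by blast
    let ?h = "H x - \<i> *\<^sub>C x"
    define c where "c = \<bar>T\<bar> + 1"
    define d where "d = e / (3 * c)"
    have c: "c > 0" unfolding c_def by linarith
    hence d: "d > 0" and dc: "d * c = e / 3" using e by (auto simp: d_def)
    have e3: "e / 3 > 0" using e by simp
    from uniform_limitD[OF orbit[of ?h] d] uniform_limitD[OF orbit[of x] e3] tendstoD[OF Rs_conv[of x] e3]
    show "\<forall>\<^sub>F s in F. \<forall>t\<in>{-T..T}. dist (unitary_exp (B s) t f) (U t f) < e"
    proof eventually_elim
      case (elim s)
      show ?case
      proof
        fix t assume t: "t \<in> {-T..T}"
        have "norm (Rs s (U t x) - unitary_exp (B s) t (Rs s x)) \<le> d * \<bar>t\<bar>"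
          using elim(1) t by (intro duh[OF x(1)]) (auto intro: less_imp_le)
        also have "d * \<bar>t\<bar> \<le> d * c" using d t by (intro mult_left_mono) (auto simp: c_def)
        finally have "dist (unitary_exp (B s) t (Rs s x)) (Rs s (U t x)) \<le> e / 3"
          by (simp add: dc dist_norm norm_minus_commute)
        moreover have "dist (unitary_exp (B s) t (R x)) (unitary_exp (B s) t (Rs s x)) < e / 3"
          using elim(3) by (simp add: dist_norm ugroup.norm_U_diff[OF ug] norm_minus_commute)
        moreover have "dist (Rs s (U t x)) (R (U t x)) < e / 3" using elim(2) t by blast
        moreover have "U t f = R (U t x)" by (simp add: x(2) R_def Res_U)
        ultimately show "dist (unitary_exp (B s) t f) (U t f) < e"
          using dist_triangle[of "unitary_exp (B s) t (R x)" "R (U t x)" "unitary_exp (B s) t (Rs s x)"]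
            dist_triangle[of "unitary_exp (B s) t (Rs s x)" "R (U t x)" "Rs s (U t x)"] x(2) by simp
      qed
    qed
  qed
  \<comment> \<open>\<open>R\<close> is continuous and its range contains \<open>D\<close>, so it
    maps the dense set \<open>D\<close> onto a dense set.\<close>
  moreover have "closure (R ` D) = UNIV"
  proof -
    have "continuous_on (closure D) R"
      unfolding R_def by (intro linear_continuous_on bounded_clinear_bounded_linear bounded_clinear_Res) simp
    hence "R ` closure D \<subseteq> closure (R ` D)"
      by (rule image_closure_subset) (simp_all add: closure_subset)
    moreover have "D \<subseteq> range R"
    proof
      fix x assume "x \<in> D"
      from R_shift[OF this, symmetric] show "x \<in> range R" by (rule range_eqI)
    qed
    ultimately have "D \<subseteq> closure (R ` D)" using dense by auto
    hence "closure D \<subseteq> closure (R ` D)" by (simp add: closure_minimal)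
    thus ?thesis using dense by auto
  qed
  ultimately show ?thesis
    using uniform_limit_dense[where K = 1 and D = "R ` D" and L = "\<lambda>s. unitary_exp (B s)" and M = U]
    by (simp only: dist_norm ugroup.norm_U_diff[OF ug] norm_U_diff mult_1_left order_refl)
qed

section \<open>Inner limits\<close>

text \<open>Pascal's rule: each power of \<open>X\<close> collects one contribution from either
  summand of the operator.\<close>

lemma funpow_binomial:
  fixes X :: "'a::complex_inner \<Rightarrow> 'a"
  assumes X: "bounded_clinear X"
  shows "((\<lambda>g. a *\<^sub>C g + b *\<^sub>C X g) ^^ k) f =
    (\<Sum>q=0..k. (of_nat (k choose q) * a ^ (k - q) * b ^ q) *\<^sub>C (X ^^ q) f)"
proof (induction k)
  case (Suc k)
  note lin = linear_simps[OF bounded_clinear_bounded_linear[OF X]] bounded_clinear_scaleC[OF X]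
  let ?t = "\<lambda>j q. (of_nat (k choose j) * a ^ (Suc k - q) * b ^ q) *\<^sub>C (X ^^ q) f"
  have X_sum: "X (\<Sum>q\<in>A. g q) = (\<Sum>q\<in>A. X (g q))" for A and g :: "nat \<Rightarrow> 'a"
    using bounded_clinear_bounded_linear[OF X] by (simp add: linear_sum bounded_linear.linear)
  have "((\<lambda>g. a *\<^sub>C g + b *\<^sub>C X g) ^^ Suc k) f =
      (\<Sum>q=0..k. ?t q q) + (\<Sum>q=0..k. ?t q (Suc q))"
    unfolding funpow.simps o_apply Suc.IH X_sum scaleC_sum_right
    by (intro arg_cong2[where f = plus] sum.cong refl)
      (auto simp: lin scaleC_scaleC Suc_diff_le mult_ac)
  \<comment> \<open>The additional term vanishes because \<open>k choose Suc k = 0\<close>.\<close>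
  also have "(\<Sum>q=0..k. ?t q q) = (\<Sum>q=0..Suc k. ?t q q)" by simp
  also have "\<dots> = ?t 0 0 + (\<Sum>q=0..k. ?t (Suc q) (Suc q))"
    by (simp only: sum.atLeast0_atMost_Suc_shift o_def)
  also have "\<dots> + (\<Sum>q=0..k. ?t q (Suc q)) =
      ?t 0 0 + (\<Sum>q=0..k. (of_nat (Suc k choose Suc q) * a ^ (Suc k - Suc q) * b ^ Suc q) *\<^sub>C (X ^^ Suc q) f)"
    unfolding add.assoc sum.distrib[symmetric] scaleC_add_left[symmetric]
    by (simp add: algebra_simps)
  also have "\<dots> = (\<Sum>q=0..Suc k. (of_nat (Suc k choose q) * a ^ (Suc k - q) * b ^ q) *\<^sub>C (X ^^ q) f)"
    unfolding sum.atLeast0_atMost_Suc_shift o_def by simp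
  finally show ?case .
qed simp

text \<open>Since \<open>(k choose q) / k\<^sup>q \<le> 1 / q!\<close>, the distance to the partial sum of the exponential series is
  dominated by the corresponding scalar expression with \<open>onorm Y\<close> in place of \<open>Y\<close>.\<close>

lemma euler_limit_sum:
  fixes Y :: "'a::banach \<Rightarrow> 'a"
  assumes Y: "bounded_linear Y"
  shows "(\<lambda>k. \<Sum>q=0..k. (real (k choose q) / real k ^ q) *\<^sub>R (Y ^^ q) f) \<longlonglongrightarrow> op_exp Y f"
proof -
  define M where "M = onorm Y"
  define P where "P = (\<lambda>k. \<Sum>q=0..k. (Y ^^ q) f /\<^sub>R fact q)"
  define E where "E = (\<lambda>k. \<Sum>q=0..k. (real (k choose q) / real k ^ q) *\<^sub>R (Y ^^ q) f)"
  have M: "M \<ge> 0" unfolding M_def by (rule onorm_pos_le[OF Y])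
  have P: "P \<longlonglongrightarrow> op_exp Y f"
    using op_exp_sums[OF Y, of f] by (simp add: sums_def' P_def)
  have le: "norm (P k - E k) \<le> norm f * ((\<Sum>q=0..k. M ^ q /\<^sub>R fact q) - (1 + M / real k) ^ k)" for k
  proof -
    have c: "real (k choose q) / real k ^ q \<le> inverse (fact q)" if "k > 0" for q
    proof -
      have "real ((k choose q) * fact q) \<le> real (k ^ q)"
        using binomial_fact_pow[of k q] by (simp only: of_nat_le_iff)
      hence "real (k choose q) * fact q \<le> real k ^ q" by simp
      thus ?thesis using that by (simp add: field_simps)
    qed
    \<comment> \<open>For \<open>k = 0\<close> only \<open>q = 0\<close> contributes, where
      \<open>0 choose 0\<close> and \<open>0 ^ 0\<close> are both 1.\<close>
    have c': "real (k choose q) / real k ^ q \<le> inverse (fact q)" for q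
      using c[of q] by (cases "k = 0"; cases q) auto
    have "norm (P k - E k) = norm (\<Sum>q=0..k. (inverse (fact q) - real (k choose q) / real k ^ q) *\<^sub>R (Y ^^ q) f)"
      by (simp add: P_def E_def sum_subtractf scaleR_diff_left)
    also have "\<dots> \<le> (\<Sum>q=0..k. (inverse (fact q) - real (k choose q) / real k ^ q) * (M ^ q * norm f))"
    proof (rule sum_norm_le)
      fix q
      show "norm ((inverse (fact q) - real (k choose q) / real k ^ q) *\<^sub>R (Y ^^ q) f) \<le>
          (inverse (fact q) - real (k choose q) / real k ^ q) * (M ^ q * norm f)"
        using mult_left_mono[OF norm_funpow_le[OF Y, of q f], of "inverse (fact q) - real (k choose q) / real k ^ q"] c'[of q]
        by (simp add: M_def)
    qed
    also have "\<dots> = norm f * ((\<Sum>q=0..k. M ^ q /\<^sub>R fact q) - (\<Sum>q=0..k. real (k choose q) * (M / real k) ^ q))"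
      by (simp add: sum_distrib_left sum_subtractf[symmetric] power_divide algebra_simps)
    also have "(\<Sum>q=0..k. real (k choose q) * (M / real k) ^ q) = (1 + M / real k) ^ k"
      using binomial_ring[of "M / real k" 1 k] by (simp add: atLeast0AtMost add.commute)
    finally show ?thesis .
  qed
  have "(\<lambda>k. norm f * ((\<Sum>q=0..k. M ^ q /\<^sub>R fact q) - (1 + M / real k) ^ k)) \<longlonglongrightarrow>
      norm f * (exp M - exp M)"
    using exp_converges[of M] by (intro tendsto_intros tendsto_exp_limit_sequentially) (simp add: sums_def')
  hence lim: "(\<lambda>k. norm f * ((\<Sum>q=0..k. M ^ q /\<^sub>R fact q) - (1 + M / real k) ^ k)) \<longlonglongrightarrow> 0"
    by simp
  have "(\<lambda>k. P k - E k) \<longlonglongrightarrow> 0"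
    by (rule Lim_null_comparison[OF always_eventually lim]) (rule allI, rule le)
  from tendsto_diff[OF P this] show ?thesis by (simp add: E_def)
qed

lemma bounded_clinear_diff_id:
  assumes "bounded_clinear S"
  shows "bounded_clinear (\<lambda>g. S g - g)"
  using assms by (simp add: bounded_clinear_def bounded_linear_sub bounded_linear_ident scaleC_diff_right)

lemma funpow_scaleC:
  assumes "bounded_clinear X"
  shows "((\<lambda>g. c *\<^sub>C X g) ^^ m) f = c ^ m *\<^sub>C (X ^^ m) f"
  by (induction m) (simp_all add: bounded_clinear_scaleC[OF assms] scaleC_scaleC mult.commute)

text \<open>These are the inner limits for a fixed outer index \<open>n\<close>: \<open>S\<close>
  stands for the operator at \<open>\<bar>t / n\<bar>\<close>, and \<open>c\<close> for
  \<open>\<i> a n sgn t\<close>.\<close>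

context
  fixes S :: "'a::complex_hilbert \<Rightarrow> 'a" and c :: complex and f :: 'a
  assumes S: "bounded_clinear S"
begin

lemma power_series_limit:
  "(\<lambda>k. \<Sum>m=0..k. (c ^ m / fact m) *\<^sub>C ((\<lambda>g. S g - g) ^^ m) f)
    \<longlonglongrightarrow> op_exp (\<lambda>g. c *\<^sub>C (S g - g)) f"
proof -
  note X = bounded_clinear_diff_id[OF S]
  have "((\<lambda>g. c *\<^sub>C (S g - g)) ^^ m) f /\<^sub>R fact m = (c ^ m / fact m) *\<^sub>C ((\<lambda>g. S g - g) ^^ m) f" for m
    unfolding funpow_scaleC[OF X] scaleC_of_real[symmetric] by (simp add: scaleC_scaleC field_simps)
  moreover have "(\<lambda>m. ((\<lambda>g. c *\<^sub>C (S g - g)) ^^ m) f /\<^sub>R fact m) sums op_exp (\<lambda>g. c *\<^sub>C (S g - g)) f"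
    by (intro op_exp_sums bounded_clinear_bounded_linear bounded_clinear_scaleC_comp X)
  ultimately show ?thesis by (simp add: sums_def')
qed

lemma power_series_limit_expanded:
  "(\<lambda>k. \<Sum>m=0..k. \<Sum>q=0..m. ((-1) ^ (m - q) * c ^ m / (fact q * fact (m - q))) *\<^sub>C (S ^^ q) f)
    \<longlonglongrightarrow> op_exp (\<lambda>g. c *\<^sub>C (S g - g)) f"
proof -
  have eq: "(\<lambda>g. S g - g) = (\<lambda>g. (-1) *\<^sub>C g + 1 *\<^sub>C S g)" by (simp add: scaleC_minus_left)
  have "(c ^ m / fact m) *\<^sub>C ((\<lambda>g. S g - g) ^^ m) f =
      (\<Sum>q=0..m. ((-1) ^ (m - q) * c ^ m / (fact q * fact (m - q))) *\<^sub>C (S ^^ q) f)" for m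
    unfolding eq funpow_binomial[OF S] scaleC_sum_right
  proof (rule sum.cong)
    fix q assume "q \<in> {0..m}"
    hence "of_nat (m choose q) = (fact m / (fact q * fact (m - q)) :: complex)"
      by (simp add: binomial_fact)
    thus "(c ^ m / fact m) *\<^sub>C (of_nat (m choose q) * (-1) ^ (m - q) * 1 ^ q) *\<^sub>C (S ^^ q) f =
        ((-1) ^ (m - q) * c ^ m / (fact q * fact (m - q))) *\<^sub>C (S ^^ q) f"
      by (simp add: scaleC_scaleC mult.commute)
  qed simp
  with power_series_limit show ?thesis by simp
qed

lemma euler_limit:
  "(\<lambda>k. ((\<lambda>g. (1 - c / of_nat k) *\<^sub>C g + (c / of_nat k) *\<^sub>C S g) ^^ k) f)
    \<longlonglongrightarrow> op_exp (\<lambda>g. c *\<^sub>C (S g - g)) f"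
proof -
  have Y: "bounded_clinear (\<lambda>g. c *\<^sub>C (S g - g))"
    by (intro bounded_clinear_scaleC_comp bounded_clinear_diff_id S)
  \<comment> \<open>The operator is \<open>I + Y / k\<close> with \<open>Y = c (S - I)\<close>, also
    at \<open>k = 0\<close>, where division by 0 gives 0.\<close>
  have "(\<lambda>g. (1 - c / of_nat k) *\<^sub>C g + (c / of_nat k) *\<^sub>C S g) =
      (\<lambda>g. 1 *\<^sub>C g + (1 / of_nat k) *\<^sub>C c *\<^sub>C (S g - g))" for k
    by (simp add: fun_eq_iff scaleC_simps)
  hence "((\<lambda>g. (1 - c / of_nat k) *\<^sub>C g + (c / of_nat k) *\<^sub>C S g) ^^ k) f =
      (\<Sum>q=0..k. (real (k choose q) / real k ^ q) *\<^sub>R ((\<lambda>g. c *\<^sub>C (S g - g)) ^^ q) f)" for k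
    unfolding scaleC_of_real[symmetric]
    by (simp only: funpow_binomial[OF Y]) (simp add: power_divide)
  thus ?thesis
    using euler_limit_sum[OF bounded_clinear_bounded_linear[OF Y], of f] by simp
qed

lemma euler_limit_binomial:
  "(\<lambda>k. \<Sum>q=0..k. (fact k * (of_nat k - c) ^ (k - q) * c ^ q / (fact q * fact (k - q) * of_nat k ^ k)) *\<^sub>C (S ^^ q) f)
    \<longlonglongrightarrow> op_exp (\<lambda>g. c *\<^sub>C (S g - g)) f"
proof (rule Lim_transform_eventually[OF euler_limit])
  show "\<forall>\<^sub>F k in sequentially. ((\<lambda>g. (1 - c / of_nat k) *\<^sub>C g + (c / of_nat k) *\<^sub>C S g) ^^ k) f =
      (\<Sum>q=0..k. (fact k * (of_nat k - c) ^ (k - q) * c ^ q / (fact q * fact (k - q) * of_nat k ^ k)) *\<^sub>C (S ^^ q) f)"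
    using eventually_gt_at_top[of 0]
  proof eventually_elim
    case (elim k)
    show ?case
      unfolding funpow_binomial[OF S]
    proof (rule sum.cong)
      fix q assume q: "q \<in> {0..k}"
      \<comment> \<open>This equation fails at \<open>k = 0\<close>, hence the restriction to
        positive \<open>k\<close>.\<close>
      have "1 - c / of_nat k = (of_nat k - c) / of_nat k" using elim by (simp add: field_simps)
      moreover have "of_nat k ^ k = (of_nat k ^ (k - q) * of_nat k ^ q :: complex)"
        using q by (simp flip: power_add)
      ultimately have "of_nat (k choose q) * (1 - c / of_nat k) ^ (k - q) * (c / of_nat k) ^ q =
          fact k * (of_nat k - c) ^ (k - q) * c ^ q / (fact q * fact (k - q) * of_nat k ^ k)"
        using q by (simp add: binomial_fact power_divide)
      thus "(of_nat (k choose q) * (1 - c / of_nat k) ^ (k - q) * (c / of_nat k) ^ q) *\<^sub>C (S ^^ q) f =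
          (fact k * (of_nat k - c) ^ (k - q) * c ^ q / (fact q * fact (k - q) * of_nat k ^ k)) *\<^sub>C (S ^^ q) f"
        by simp
    qed simp
  qed
qed

text \<open>The power \<open>(1 - c / k) ^ (k - m)\<close> is expanded once more, with
  \<open>q\<close> the exponent of 1. The factors \<open>c / k\<close> then number
  \<open>(k - m - q) + m = k - q\<close>, and the two binomial coefficients merge into a trinomial
  one.\<close>

lemma euler_limit_trinomial:
  "(\<lambda>k. \<Sum>m=0..k. \<Sum>q=0..k - m.
      ((-1) ^ (k - m - q) * fact k * c ^ (k - q) / (fact m * fact q * fact (k - m - q) * of_nat k ^ (k - q))) *\<^sub>C (S ^^ m) f)
    \<longlonglongrightarrow> op_exp (\<lambda>g. c *\<^sub>C (S g - g)) f"
proof -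
  have "(of_nat (k choose m) * (1 - c / of_nat k) ^ (k - m) * (c / of_nat k) ^ m) *\<^sub>C (S ^^ m) f =
      (\<Sum>q=0..k - m. ((-1) ^ (k - m - q) * fact k * c ^ (k - q) /
        (fact m * fact q * fact (k - m - q) * of_nat k ^ (k - q))) *\<^sub>C (S ^^ m) f)"
    if m: "m \<le> k" for k m
  proof -
    have "(1 - c / of_nat k) ^ (k - m) =
        (\<Sum>q=0..k - m. of_nat (k - m choose q) * ((-1) ^ (k - m - q) * (c / of_nat k) ^ (k - m - q)))"
      using binomial_ring[of 1 "- (c / of_nat k)" "k - m"]
      by (simp add: atLeast0AtMost power_minus[of "c / of_nat k"])
    hence "of_nat (k choose m) * (1 - c / of_nat k) ^ (k - m) * (c / of_nat k) ^ m =
        (\<Sum>q=0..k - m. of_nat (k choose m) *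
          (of_nat (k - m choose q) * ((-1) ^ (k - m - q) * (c / of_nat k) ^ (k - m - q))) * (c / of_nat k) ^ m)"
      by (simp add: sum_distrib_left sum_distrib_right)
    also have "\<dots> = (\<Sum>q=0..k - m. (-1) ^ (k - m - q) * fact k * c ^ (k - q) /
        (fact m * fact q * fact (k - m - q) * of_nat k ^ (k - q)))"
    proof (rule sum.cong)
      fix q assume q: "q \<in> {0..k - m}"
      have "k - m - q + m = k - q" using q m by auto
      hence "(c / of_nat k) ^ (k - m - q) * (c / of_nat k) ^ m = c ^ (k - q) / of_nat k ^ (k - q)"
        by (simp add: power_divide flip: power_add)
      moreover have "of_nat (k choose m) * of_nat (k - m choose q) =
          (fact k / (fact m * fact q * fact (k - m - q)) :: complex)"
        using q m by (simp add: binomial_fact)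
      moreover have "of_nat (k choose m) * (of_nat (k - m choose q) * ((-1) ^ (k - m - q) * (c / of_nat k) ^ (k - m - q))) * (c / of_nat k) ^ m
          = (-1) ^ (k - m - q) * (of_nat (k choose m) * of_nat (k - m choose q)) *
            ((c / of_nat k) ^ (k - m - q) * (c / of_nat k) ^ m)"
        by (simp only: mult_ac)
      ultimately show "of_nat (k choose m) * (of_nat (k - m choose q) * ((-1) ^ (k - m - q) * (c / of_nat k) ^ (k - m - q))) * (c / of_nat k) ^ m
          = (-1) ^ (k - m - q) * fact k * c ^ (k - q) / (fact m * fact q * fact (k - m - q) * of_nat k ^ (k - q))"
        by simp
    qed simp
    finally show ?thesis by (simp only: scaleC_sum_left)
  qed
  hence "((\<lambda>g. (1 - c / of_nat k) *\<^sub>C g + (c / of_nat k) *\<^sub>C S g) ^^ k) f =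
      (\<Sum>m=0..k. \<Sum>q=0..k - m. ((-1) ^ (k - m - q) * fact k * c ^ (k - q) /
        (fact m * fact q * fact (k - m - q) * of_nat k ^ (k - q))) *\<^sub>C (S ^^ m) f)" for k
    unfolding funpow_binomial[OF S] by (intro sum.cong) auto
  with euler_limit show ?thesis by simp
qed

end

lemma iterated_limitI:
  assumes "\<And>n. n > 0 \<Longrightarrow> X n \<longlonglongrightarrow> Y n" "Y \<longlonglongrightarrow> l"
  shows "iterated_limit X l"
  unfolding iterated_limit_def
proof
  show "\<forall>n>0. convergent (X n)" using assms(1) by (auto simp: convergent_def)
  have "\<forall>\<^sub>F n in sequentially. Y n = lim (X n)"
    using eventually_gt_at_top[of 0] by eventually_elim (simp add: limI[OF assms(1)])
  with assms(2) show "(\<lambda>n. lim (X n)) \<longlonglongrightarrow> l" by (rule Lim_transform_eventually)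
qed

section \<open>Chernoff approximation\<close>

lemma (in ugroup) U_funpow: "(U t ^^ n) f = U (real n * t) f"
  by (induction n arbitrary: f) (simp_all add: algebra_simps flip: U_add)

text \<open>Nonemptiness of \<open>I\<close> gives the lower bound 0: in the extended reals an empty
  supremum is \<open>-\<infinity>\<close>.\<close>

lemma tendsto_SUP_0:
  fixes w :: "nat \<Rightarrow> 't \<Rightarrow> real"
  assumes "I \<noteq> {}" "\<And>n t. w n t \<ge> 0" "\<And>e. e > 0 \<Longrightarrow> \<forall>\<^sub>F n in sequentially. \<forall>t\<in>I. w n t < e"
  shows "(\<lambda>n. SUP t\<in>I. ereal (w n t)) \<longlonglongrightarrow> 0"
proof (rule order_tendstoI)
  fix a :: ereal
  obtain t0 where t0: "t0 \<in> I" using assms(1) by blast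
  show "\<forall>\<^sub>F n in sequentially. a < (SUP t\<in>I. ereal (w n t))" if a: "a < 0"
  proof (rule always_eventually, rule allI)
    fix n
    have "0 \<le> ereal (w n t0)" using assms(2) by simp
    also have "\<dots> \<le> (SUP t\<in>I. ereal (w n t))" using t0 by (rule SUP_upper)
    finally show "a < (SUP t\<in>I. ereal (w n t))" using a by (rule less_le_trans[rotated])
  qed
  show "\<forall>\<^sub>F n in sequentially. (SUP t\<in>I. ereal (w n t)) < a" if a: "a > 0"
  proof -
    obtain e where e: "0 < ereal e" "ereal e < a" using ereal_dense2[OF a] by blast
    hence "e > 0" by simp
    from assms(3)[OF this] show ?thesis
    proof eventually_elim
      case (elim n)
      have "(SUP t\<in>I. ereal (w n t)) \<le> ereal e"
        using elim by (intro SUP_least) (auto intro: less_imp_le)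
      thus ?case using e(2) by (rule le_less_trans)
    qed
  qed
qed

text \<open>Separates the time \<open>t\<close> from the factor \<open>1 / \<bar>s\<bar>\<close>
  with step \<open>s = t / n\<close>. At \<open>t = 0\<close> both sides are 0 by the convention for
  division by 0.\<close>

lemma real_sgn_mult_eq: "n > 0 \<Longrightarrow> real n * sgn t = t / \<bar>t / real n\<bar>"
  by (cases "t = 0") (simp_all add: sgn_real_def abs_if divide_simps)

theorem theorem3p1:
  fixes S :: "real \<Rightarrow> 'a::complex_hilbert \<Rightarrow> 'a"
    and H :: "'a \<Rightarrow> 'a"
    and DomH :: "'a set"
    and a :: real
  assumes "csubspace DomH" and "closure DomH = UNIV"
    and "clinear_on DomH H" and "self_adjoint DomH H"
    and "a \<noteq> 0"
    and "chernoff_tangent S DomH H"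
    and "\<And>t. t \<ge> 0 \<Longrightarrow> cadjoint UNIV (S t) = S t"
  shows "let U = unitary_group_gen DomH (\<lambda>g. (\<i> * of_real a) *\<^sub>C H g) in
    chernoff_equivalent
       (\<lambda>t. op_exp (\<lambda>g. (\<i> * of_real a * of_real (sgn t)) *\<^sub>C (S \<bar>t\<bar> g - g)))
       U \<and>
    (\<forall>t f.
     ((\<lambda>n. (op_exp (\<lambda>g. (\<i> * of_real a * of_real (sgn t)) *\<^sub>C (S \<bar>t / real n\<bar> g - g)) ^^ n) f)
       \<longlonglongrightarrow> U t f) \<and>
     ((\<lambda>n. op_exp (\<lambda>g. (\<i> * of_real a * of_nat n * of_real (sgn t)) *\<^sub>C (S \<bar>t / real n\<bar> g - g)) f)
       \<longlonglongrightarrow> U t f) \<and>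
     iterated_limit
       (\<lambda>n k. \<Sum>m=0..k.
          (\<i> ^ m * of_real a ^ m * of_nat n ^ m * of_real (sgn t) ^ m / fact m) *\<^sub>C
            ((\<lambda>g. S \<bar>t / real n\<bar> g - g) ^^ m) f)
       (U t f) \<and>
     iterated_limit
       (\<lambda>n k. ((\<lambda>g. (1 - \<i> * of_real a * of_nat n * of_real (sgn t) / of_nat k) *\<^sub>C g +
                    (\<i> * of_real a * of_nat n * of_real (sgn t) / of_nat k) *\<^sub>C S \<bar>t / real n\<bar> g) ^^ k) f)
       (U t f) \<and>
     iterated_limit
       (\<lambda>n k. \<Sum>m=0..k. \<Sum>q=0..m.
          ((-1) ^ (m - q) * \<i> ^ m * of_real a ^ m * of_nat n ^ m * of_real (sgn t) ^ m /
             (fact q * fact (m - q))) *\<^sub>C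
            (S \<bar>t / real n\<bar> ^^ q) f)
       (U t f) \<and>
     iterated_limit
       (\<lambda>n k. \<Sum>q=0..k.
          (fact k * (of_nat k - \<i> * of_real a * of_nat n * of_real (sgn t)) ^ (k - q) *
             (\<i> * of_real a * of_nat n * of_real (sgn t)) ^ q /
             (fact q * fact (k - q) * of_nat k ^ k)) *\<^sub>C
            (S \<bar>t / real n\<bar> ^^ q) f)
       (U t f) \<and>
     iterated_limit
       (\<lambda>n k. \<Sum>m=0..k. \<Sum>q=0..k - m.
          ((-1) ^ (k - m - q) * fact k * (\<i> * of_real a * of_nat n * of_real (sgn t)) ^ (k - q) /
             (fact m * fact q * fact (k - m - q) * of_nat k ^ (k - q))) *\<^sub>C
            (S \<bar>t / real n\<bar> ^^ m) f)
       (U t f))"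
proof -
  interpret H: selfadj DomH H by (rule selfadj_of_self_adjoint) fact+
  define K where "K = (\<lambda>g. of_real a *\<^sub>C H g)"
  interpret K: selfadj DomH K unfolding K_def by (rule H.selfadj_scaleR) fact
  obtain U where "ugroup DomH K U" using K.stone by blast
  then interpret U: ugroup DomH K U .
  have gen: "unitary_group_gen DomH (\<lambda>g. (\<i> * of_real a) *\<^sub>C H g) = U"
    using U.unitary_group_gen_eq by (simp add: K_def scaleC_scaleC)

  from \<open>chernoff_tangent S DomH H\<close> obtain C where
    S: "\<And>t. t \<ge> 0 \<Longrightarrow> bounded_clinear (S t)" and S0: "S 0 = id"
    and C: "C \<subseteq> deriv0_dom (at_right 0) S"
    and closure: "closure (op_graph C (deriv0 (at_right 0) S)) = op_graph DomH H"
    unfolding chernoff_tangent_def is_op_closure_def by blast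
  \<comment> \<open>A graph is contained in its closure, here the graph of \<open>H\<close>; this
    places \<open>C\<close> in the domain and identifies the derivative with \<open>H\<close>
    there.\<close>
  have C_H: "f \<in> DomH" "deriv0 (at_right 0) S f = H f" if "f \<in> C" for f
  proof -
    have "(f, deriv0 (at_right 0) S f) \<in> op_graph DomH H"
      using that closure_subset[of "op_graph C (deriv0 (at_right 0) S)"]
      unfolding closure by (auto simp: op_graph_def)
    thus "f \<in> DomH" "deriv0 (at_right 0) S f = H f" by (auto simp: op_graph_def)
  qed
  define B where "B = (\<lambda>s g. of_real (a / \<bar>s\<bar>) *\<^sub>C (S \<bar>s\<bar> g - g))"
    \<comment> \<open>\<open>B 0 = 0\<close>, since \<open>a / 0 = 0\<close>; this makes \<open>B s\<close> bounded and symmetric for all \<open>s\<close>.\<close>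
  have B: "bounded_clinear (B s)" for s
    unfolding B_def by (intro bounded_clinear_scaleC_comp bounded_clinear_diff_id S) simp
  have S_sym: "cinner y (S s x) = cinner (S s y) x" if "s \<ge> 0" for s x y
    using S[OF that] assms(7)[OF that] by (rule cinner_bounded_self_adjoint)
  have B_sym: "cinner y (B s x) = cinner (B s y) x" for s x y
    unfolding B_def by (simp add: cinner_simps S_sym)
  note unitary_exp_B = unitary_exp_ugroup[OF B B_sym]
  have conv: "((\<lambda>s. B s f) \<longlongrightarrow> K f) (at_right 0)" if f: "f \<in> C" for f
  proof -
    obtain l where l: "((\<lambda>t. (S t f - f) /\<^sub>R t) \<longlongrightarrow> l) (at_right 0)"
      using f C by (auto simp: deriv0_dom_def)
    hence "l = H f" using tendsto_Lim[OF _ l] C_H(2)[OF f] by (simp add: deriv0_def)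
    hence "((\<lambda>t. of_real a *\<^sub>C ((S t f - f) /\<^sub>R t)) \<longlongrightarrow> K f) (at_right 0)"
      unfolding K_def using l by (intro tendsto_intros) simp
    moreover have "\<forall>\<^sub>F t in at_right 0. of_real a *\<^sub>C ((S t f - f) /\<^sub>R t) = B t f"
      using eventually_at_right_less[of 0]
    proof eventually_elim
      case (elim t)
      thus ?case
        unfolding B_def scaleC_of_real by (simp add: divide_inverse)
    qed
    ultimately show ?thesis by (rule Lim_transform_eventually)
  qed
  \<comment> \<open>The closure condition makes \<open>C\<close> a core: a sequence in the smaller
    graph converging to \<open>(x, H x)\<close> gives both limits componentwise.\<close>
  have core: "\<exists>c. (\<forall>n. c n \<in> C) \<and> c \<longlonglongrightarrow> x \<and> (\<lambda>n. K (c n)) \<longlonglongrightarrow> K x" if x: "x \<in> DomH" for x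
  proof -
    have "(x, H x) \<in> closure (op_graph C (deriv0 (at_right 0) S))"
      unfolding closure using x by (auto simp: op_graph_def)
    then obtain z where z: "\<And>n. z n \<in> op_graph C (deriv0 (at_right 0) S)" "z \<longlonglongrightarrow> (x, H x)"
      unfolding closure_sequential by blast
    have c: "fst (z n) \<in> C" "snd (z n) = H (fst (z n))" for n
      using z(1)[of n] C_H(2) by (auto simp: op_graph_def)
    have "(\<lambda>n. fst (z n)) \<longlonglongrightarrow> x" using tendsto_fst[OF z(2)] by simp
    moreover have "(\<lambda>n. H (fst (z n))) \<longlonglongrightarrow> H x" using tendsto_snd[OF z(2)] by (simp add: c(2))
    hence "(\<lambda>n. K (fst (z n))) \<longlonglongrightarrow> K x" unfolding K_def by (intro tendsto_intros)
    ultimately show ?thesis using c(1) by (intro exI[of _ "\<lambda>n. fst (z n)"]) simp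
  qed
  \<comment> \<open>The step \<open>t / n\<close> varies with \<open>t\<close>, but the estimate
    holds for every step in \<open>(0, d)\<close> and all times in the interval at once, so
    \<open>\<bar>T\<bar> / n < d\<close> handles all nonzero \<open>t\<close>. As \<open>B\<close>
    is even, negative \<open>t\<close> reduce to positive steps; at \<open>t = 0\<close> both groups
    are the identity.\<close>
  have approx: "\<forall>\<^sub>F n in sequentially. \<forall>t\<in>{-T..T}. dist (unitary_exp (B (t / real n)) t f) (U t f) < e"
    if e: "e > 0" for T f e
  proof -
    have "uniform_limit {-T..T} (\<lambda>s t. unitary_exp (B s) t f) (\<lambda>t. U t f) (at_right 0)"
      using C_H(1) by (intro U.unitary_exp_uniform_limit[OF B B_sym _ core conv]) auto
    from uniform_limitD[OF this e] obtain d where d: "d > 0"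
      "\<And>s. 0 < s \<Longrightarrow> s < d \<Longrightarrow> \<forall>t\<in>{-T..T}. dist (unitary_exp (B s) t f) (U t f) < e"
      unfolding eventually_at_right_field by blast
    obtain N where N: "\<bar>T\<bar> < real N * d" using reals_Archimedean3[OF d(1)] by blast
    show ?thesis
      using eventually_gt_at_top[of "max 0 N"]
    proof eventually_elim
      case (elim n)
      show ?case
      proof
        fix t assume t: "t \<in> {-T..T}"
        show "dist (unitary_exp (B (t / real n)) t f) (U t f) < e"
        proof (cases "t = 0")
          case True
          thus ?thesis using e ugroup.U_0[OF unitary_exp_B] by simp
        next
          case False
          have n: "real n > 0" "real n > real N" using elim by auto
          have "\<bar>t\<bar> \<le> \<bar>T\<bar>" using t by auto
          also have "\<dots> < real N * d" by (rule N)
          also have "\<dots> \<le> real n * d" using n d(1) by (intro mult_right_mono) auto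
          finally have "\<bar>t\<bar> / real n < d" using n by (simp add: field_simps)
          moreover have "0 < \<bar>t\<bar> / real n" using False n by simp
          ultimately have "dist (unitary_exp (B (\<bar>t\<bar> / real n)) t f) (U t f) < e" using d(2) t by blast
          moreover have "B (\<bar>t\<bar> / real n) = B (t / real n)" by (simp add: B_def)
          ultimately show ?thesis by simp
        qed
      qed
    qed
  qed
  have op_exp_eq: "op_exp (\<lambda>g. (\<i> * of_real a * of_nat n * of_real (sgn t)) *\<^sub>C (S \<bar>t / real n\<bar> g - g)) =
      unitary_exp (B (t / real n)) t" if n: "n > 0" for n t
  proof -
    have "a * real n * sgn t = t * (a / \<bar>t / real n\<bar>)"
      using real_sgn_mult_eq[OF n, of t] by (simp add: mult.assoc)
    hence "\<i> * of_real a * of_nat n * of_real (sgn t) = (\<i> * of_real t) * complex_of_real (a / \<bar>t / real n\<bar>)"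
      by (metis mult.assoc of_real_mult of_real_of_nat_eq)
    thus ?thesis by (simp only: unitary_exp_def B_def scaleC_scaleC abs_abs)
  qed
  define G where "G = (\<lambda>t. op_exp (\<lambda>g. (\<i> * of_real a * of_real (sgn t)) *\<^sub>C (S \<bar>t\<bar> g - g)))"
  have G: "G t = unitary_exp (B t) t" for t using op_exp_eq[of 1 t] by (simp add: G_def)
  \<comment> \<open>All factors of the \<open>n\<close>th power belong to the group of the one
    operator \<open>B (t / n)\<close>, so the power only multiplies the time \<open>t / n\<close> by
    \<open>n\<close>.\<close>
  have G_pow: "(G (t / real n) ^^ n) f = unitary_exp (B (t / real n)) t f" if "n > 0" for t n f
    using that by (simp add: G ugroup.U_funpow[OF unitary_exp_B])
  have G_lim: "(\<lambda>n. unitary_exp (B (t / real n)) t f) \<longlonglongrightarrow> U t f" for t f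
  proof (rule tendstoI)
    fix e :: real assume "e > 0"
    from approx[OF this, of "\<bar>t\<bar>" f]
    show "\<forall>\<^sub>F n in sequentially. dist (unitary_exp (B (t / real n)) t f) (U t f) < e"
      by (rule eventually_mono) (erule bspec, auto)
  qed
  have exp_lim: "(\<lambda>n. op_exp (\<lambda>g. (\<i> * of_real a * of_nat n * of_real (sgn t)) *\<^sub>C (S \<bar>t / real n\<bar> g - g)) f)
      \<longlonglongrightarrow> U t f" for t f
    by (rule Lim_transform_eventually[OF G_lim eventually_mono[OF eventually_gt_at_top[of 0]]])
      (simp only: op_exp_eq)
  have "chernoff_equivalent G U"
    unfolding chernoff_equivalent_def
  proof (intro conjI allI impI)
    show "bounded_clinear (G t)" for t unfolding G by (rule ugroup.U_bounded_clinear[OF unitary_exp_B])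
    show "bounded_clinear (U t)" for t by (rule U.U_bounded_clinear)
    show "G 0 = id" by (simp add: fun_eq_iff G ugroup.U_0[OF unitary_exp_B])
    show "U 0 = id" by (simp add: fun_eq_iff)
    fix f and T :: real assume "T > 0"
    show "(\<lambda>n. SUP t\<in>{-T..T}. ereal (norm ((G (t / real n) ^^ n) f - (U (t / real n) ^^ n) f))) \<longlonglongrightarrow> 0"
    proof (rule tendsto_SUP_0)
      fix e :: real assume "e > 0"
      from approx[OF this, of T f] eventually_gt_at_top[of 0]
      show "\<forall>\<^sub>F n in sequentially. \<forall>t\<in>{-T..T}. norm ((G (t / real n) ^^ n) f - (U (t / real n) ^^ n) f) < e"
        by eventually_elim (simp add: G_pow U.U_funpow dist_norm)
    qed (use \<open>T > 0\<close> in auto)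
  qed
  moreover have "(\<lambda>n. (op_exp (\<lambda>g. (\<i> * of_real a * of_real (sgn t)) *\<^sub>C (S \<bar>t / real n\<bar> g - g)) ^^ n) f)
      \<longlonglongrightarrow> U t f" for t f
  proof (rule Lim_transform_eventually[OF G_lim])
    show "\<forall>\<^sub>F n in sequentially. unitary_exp (B (t / real n)) t f =
        (op_exp (\<lambda>g. (\<i> * of_real a * of_real (sgn t)) *\<^sub>C (S \<bar>t / real n\<bar> g - g)) ^^ n) f"
      using eventually_gt_at_top[of 0]
    proof eventually_elim
      case (elim n)
      hence "sgn (t / real n) = sgn t" by (simp add: sgn_divide)
      thus ?case using G_pow[OF elim, of t f] by (simp add: G_def)
    qed
  qed
  ultimately show ?thesis
    unfolding Let_def gen G_def[symmetric]
    using exp_lim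
      iterated_limitI[OF power_series_limit[OF S[OF abs_ge_zero]] exp_lim]
      iterated_limitI[OF euler_limit[OF S[OF abs_ge_zero]] exp_lim]
      iterated_limitI[OF power_series_limit_expanded[OF S[OF abs_ge_zero]] exp_lim]
      iterated_limitI[OF euler_limit_binomial[OF S[OF abs_ge_zero]] exp_lim]
      iterated_limitI[OF euler_limit_trinomial[OF S[OF abs_ge_zero]] exp_lim]
    by (intro conjI allI) (simp_all only: power_mult_distrib mult.assoc)
qed

end
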